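(* Let $m$ be an elementary semi-measure and let all complexity quantities be relativized to $m$. Then for every finite set $D\subset\{0,1\}^*$, $$\min_{x\in D}\mathbf{K}(x)\le -\log m(D)+2\mathbf{K}(\lceil-\log m(D)\rceil)+\Lambda(\langle D\rangle)+O(1).$$
   Context: An elementary semi-measure is a function $m:\{0,1\}^*\to\mathbb{Q}_{\ge0}$ with finite support and $\sum_a m(a)\le1$ (an elementary probability measure if the sum is $1$); $m(D)=\sum_{x\in D}m(x)$. $\langle\cdot\rangle$ is a fixed self-delimiting encoding of strings (e.g. $1^{\|x\|}0x$), finite sets $\{a_1,\dots,a_n\}$ are encoded as $\langle n\rangle\langle a_1\rangle\cdots\langle a_n\rangle$, and elementary measures are encoded as finite strings. $U$ is a fixed universal prefix-free machine with auxiliary input tape, assumed left-total (if $U_\alpha(y)$ halts and $z0\sqsubseteq x$, $z1\sqsubseteq y$ for some $z$, there is a finite prefix-free $G$ with $\sum_{w\in G}2^{-\|w\|}=1$ and $U_\alpha(xw)$ halting for all $w\in G$). $\mathbf{K}(x|y)=\min\{\|p\|:U_y(p)=x\}$, $\mathbf{K}(x)=\mathbf{K}(x|\emptyset)$. For an elementary probability measure $W$, $\mathbf{d}(a|W,y)=\lfloor-\log W(a)\rfloor-\mathbf{K}(a|y)$. The stochasticity is $\Lambda(a|y)=\min\{j+3\log k: \exists v\in\{0,1\}^j,\ U_y(v)=\langle W\rangle \text{ for an elementary probability measure }W,\ \mathbf{d}(a|W,\langle v,y\rangle)\le k,\ k\in\{1,2,\dots\}\}$, and $\Lambda(a)=\Lambda(a|\emptyset)$.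 "Relativized to $m$" means an encoding of $m$ is provided to $U$ on an auxiliary tape, so all complexities (including those inside $\Lambda$) are implicitly conditioned on it. *)

theory Defs
  imports Complex_Main "HOL-Library.Sublist" "HOL-Library.Extended_Real"
begin

section \<open>Partial recursive functions\<close>

datatype recf =
    Zero
  | Succ
  | Proj nat
  | Comp recf "recf list"
  | PrimRec recf recf
  | Mu recf

text \<open>Kleene's partial recursive functions; the value None means divergence (or a wrong number of
  arguments). Composition is strict. \<open>Mu\<close> is unbounded search, which diverges if it meets an
  undefined value before the first zero.\<close>

fun eval :: "recf \<Rightarrow> nat list \<Rightarrow> nat option" where
  "eval Zero xs = Some 0"
| "eval Succ xs = (case xs of [] \<Rightarrow> None | x # _ \<Rightarrow> Some (Suc x))"
| "eval (Proj i) xs = (if i < length xs then Some (xs ! i) else None)"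
| "eval (Comp f gs) xs =
     Option.bind (those (map (\<lambda>g. eval g xs) gs)) (\<lambda>ys. eval f ys)"
| "eval (PrimRec f g) xs =
     (case xs of [] \<Rightarrow> None
      | n # ys \<Rightarrow>
          rec_nat (eval f ys) (\<lambda>i r. Option.bind r (\<lambda>r. eval g (i # r # ys))) n)"
| "eval (Mu f) xs =
     (if \<exists>n. eval f (n # xs) = Some 0 \<and> (\<forall>i<n. eval f (i # xs) \<noteq> None)
      then Some (LEAST n. eval f (n # xs) = Some 0) else None)"


section \<open>Strings and encodings\<close>

type_synonym str = "bool list"

text \<open>The length-lexicographic bijection between strings and naturals
  (\<open>\<epsilon>, 0, 1, 00, 01, \<dots>\<close> correspond to \<open>0, 1, 2, 3, 4, \<dots>\<close>).\<close>

definition str_nat :: "str \<Rightarrow> nat" where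
  "str_nat x = foldl (\<lambda>n b. 2 * n + (if b then 2 else 1)) 0 x"

fun nat_str :: "nat \<Rightarrow> str" where
  "nat_str n = (if n = 0 then [] else nat_str ((n - 1) div 2) @ [even n])"

declare nat_str.simps [simp del]

lemma str_nat_Nil [simp]: "str_nat [] = 0"
  by (simp add: str_nat_def)

lemma str_nat_snoc [simp]: "str_nat (x @ [b]) = 2 * str_nat x + (if b then 2 else 1)"
  by (simp add: str_nat_def)

lemma str_nat_nat_str [simp]: "str_nat (nat_str n) = n"
proof (induction n rule: less_induct)
  case (less n)
  show ?case
  proof (cases "n = 0")
    case True
    then show ?thesis by (simp add: nat_str.simps)
  next
    case False
    then have "str_nat (nat_str ((n - 1) div 2)) = (n - 1) div 2"
      by (intro less) auto
    with False show ?thesis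
      by (subst nat_str.simps) (auto elim!: evenE oddE)
  qed
qed

lemma nat_str_str_nat [simp]: "nat_str (str_nat x) = x"
proof (induction x rule: rev_induct)
  case Nil
  show ?case by (simp add: nat_str.simps)
next
  case (snoc b x)
  then show ?case by (subst nat_str.simps) auto
qed

text \<open>The self-delimiting code \<open>\<langle>x\<rangle> = 1\<^sup>|\<^sup>x\<^sup>|0x\<close>.\<close>

definition code :: "str \<Rightarrow> str" where
  "code x = replicate (length x) True @ False # x"

definition code_pair :: "str \<Rightarrow> str \<Rightarrow> str" where
  "code_pair x y = code x @ code y"

definition sorted_strs :: "str set \<Rightarrow> str list" where
  "sorted_strs D = map nat_str (sorted_list_of_set (str_nat ` D))"

definition code_set :: "str set \<Rightarrow> str" where
  "code_set D = code (nat_str (card D)) @ concat (map code (sorted_strs D))"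

text \<open>Nonnegative rationals only.\<close>

definition code_rat :: "rat \<Rightarrow> str" where
  "code_rat q = (case quotient_of q of (a, b) \<Rightarrow> code (nat_str (nat a)) @ code (nat_str (nat b)))"


section \<open>Elementary measures\<close>

definition supp :: "(str \<Rightarrow> rat) \<Rightarrow> str set" where
  "supp m = {a. m a \<noteq> 0}"

definition elementary_semimeasure :: "(str \<Rightarrow> rat) \<Rightarrow> bool" where
  "elementary_semimeasure m \<longleftrightarrow>
     (\<forall>a. m a \<ge> 0) \<and> finite (supp m) \<and> (\<Sum>a\<in>supp m. m a) \<le> 1"

definition elementary_probability :: "(str \<Rightarrow> rat) \<Rightarrow> bool" where
  "elementary_probability m \<longleftrightarrow>
     (\<forall>a. m a \<ge> 0) \<and> finite (supp m) \<and> (\<Sum>a\<in>supp m. m a) = 1"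

definition code_measure :: "(str \<Rightarrow> rat) \<Rightarrow> str" where
  "code_measure m =
     code (nat_str (card (supp m))) @
     concat (map (\<lambda>a. code a @ code_rat (m a)) (sorted_strs (supp m)))"


section \<open>Prefix-free machines\<close>

text \<open>The first argument is the content of the auxiliary tape, the second the program.\<close>

type_synonym machine = "str \<Rightarrow> str \<Rightarrow> str option"

definition computable_machine :: "machine \<Rightarrow> bool" where
  "computable_machine T \<longleftrightarrow>
     (\<exists>r. \<forall>y p. eval r [str_nat y, str_nat p] = map_option str_nat (T y p))"

definition prefix_free :: "str set \<Rightarrow> bool" where
  "prefix_free G \<longleftrightarrow> (\<forall>v\<in>G. \<forall>w\<in>G. prefix v w \<longrightarrow> v = w)"

definition prefix_free_machine :: "machine \<Rightarrow> bool" where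
  "prefix_free_machine T \<longleftrightarrow>
     computable_machine T \<and> (\<forall>y. prefix_free {p. T y p \<noteq> None})"

text \<open>Universality is additive optimality of \<open>U\<close> for the complexity it defines, uniformly in the
  auxiliary input: every program of \<open>T\<close> has a \<open>U\<close>-program with the same output that is longer by
  at most a constant. The form \<open>U\<^sub>y(tp) = T\<^sub>y(p)\<close> with a fixed string \<open>t\<close> would
  contradict left-totality (let \<open>T\<close> halt on the program \<open>1\<close> only).\<close>

definition universal_machine :: "machine \<Rightarrow> bool" where
  "universal_machine U \<longleftrightarrow>
     prefix_free_machine U \<and>
     (\<forall>T. prefix_free_machine T \<longrightarrow>
       (\<exists>c. \<forall>y p x. T y p = Some x \<longrightarrow>
         (\<exists>q. U y q = Some x \<and> length q \<le> length p + c)))"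

text \<open>Left-totality concerns strings \<open>x\<close> that the machine can still be reading. If a proper
  prefix of \<open>x\<close> is already a halting program, no extension of \<open>x\<close> is one because the domain is
  prefix-free, so such \<open>x\<close> have to be left out.\<close>

definition left_total_machine :: "machine \<Rightarrow> bool" where
  "left_total_machine U \<longleftrightarrow>
     (\<forall>\<alpha> x y z.
        U \<alpha> y \<noteq> None \<and> prefix (z @ [False]) x \<and> prefix (z @ [True]) y \<and>
        (\<forall>u. strict_prefix u x \<longrightarrow> U \<alpha> u = None) \<longrightarrow>
        (\<exists>G. finite G \<and> prefix_free G \<and> (\<Sum>w\<in>G. (1/2::real) ^ length w) = 1 \<and>
             (\<forall>w\<in>G. U \<alpha> (x @ w) \<noteq> None)))"


section \<open>Complexity, deficiency of randomness, stochasticity\<close>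

definition KP :: "machine \<Rightarrow> str \<Rightarrow> str \<Rightarrow> nat" where
  "KP U x y = (LEAST n. \<exists>p. U y p = Some x \<and> length p = n)"

text \<open>The deficiency is infinite outside the support of \<open>W\<close>; in HOL, \<open>log 2 0 = 0\<close>.\<close>

definition deficiency :: "machine \<Rightarrow> str \<Rightarrow> (str \<Rightarrow> rat) \<Rightarrow> str \<Rightarrow> ereal" where
  "deficiency U a W y =
     (if W a = 0 then \<infinity>
      else ereal (real_of_int (\<lfloor>- log 2 (of_rat (W a))\<rfloor> - int (KP U a y))))"

definition stoch_values :: "machine \<Rightarrow> str \<Rightarrow> str \<Rightarrow> real set" where
  "stoch_values U a y =
     {real j + 3 * log 2 (real k) | j k.
        k \<ge> 1 \<and>
        (\<exists>v W. length v = j \<and> elementary_probability W \<and> U y v = Some (code_measure W) \<and>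
               deficiency U a W (code_pair v y) \<le> ereal (real k))}"

definition stochasticity :: "machine \<Rightarrow> str \<Rightarrow> str \<Rightarrow> real" where
  "stochasticity U a y = Inf (stoch_values U a y)"


section \<open>The minima exist\<close>

text \<open>Every string is the output of some program of a universal machine: compare with the machine
  that maps \<open>1\<^sup>n0\<close> to the \<open>n\<close>-th string.\<close>

definition "unary_prog n = replicate n True @ [False]"

lemma foldl_True:
  "foldl (\<lambda>n b. 2 * n + (if b then 2 else 1)) m (replicate n True) = 2 ^ n * (m + 2) - (2::nat)"
  by (induction n arbitrary: m) (auto simp: algebra_simps)

lemma str_nat_unary_prog: "str_nat (unary_prog n) = 4 * 2 ^ n - 3"
proof -
  have "Suc (2 * (q * 2 - 2)) = 4 * q - 3" if "1 \<le> q" for q :: nat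
    using that by linarith
  from this [of "2 ^ n"] show ?thesis
    unfolding unary_prog_def str_nat_snoc using foldl_True [of 0 n]
    by (simp add: str_nat_def)
qed

lemma unary_prog_rec: "unary_prog 0 = [False]" "unary_prog (Suc n) = True # unary_prog n"
  by (simp_all add: unary_prog_def)

lemma unary_prog_inj: "prefix (unary_prog m) (unary_prog n) \<Longrightarrow> m = n"
proof (induction m arbitrary: n)
  case 0
  then show ?case by (cases n) (simp_all add: unary_prog_rec)
next
  case (Suc m)
  then show ?case by (cases n) (simp_all add: unary_prog_rec)
qed

definition "rf_add = PrimRec (Proj 0) (Comp Succ [Proj 1])"
definition "rf_pred = PrimRec Zero (Proj 0)"
definition "rf_diff = PrimRec (Proj 0) (Comp rf_pred [Proj 1])"
definition "rf_dist = Comp rf_add [Comp rf_diff [Proj 0, Proj 1], Comp rf_diff [Proj 1, Proj 0]]"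
definition "rf_prog = PrimRec (Comp Succ [Zero])
  (Comp Succ [Comp Succ [Comp Succ [Comp rf_add [Proj 1, Proj 1]]]])"
definition "rf_unary = Mu (Comp rf_dist [Comp rf_prog [Proj 0], Proj 2])"

lemma eval_rf_add [simp]: "eval rf_add [a, b] = Some (a + b)"
  unfolding rf_add_def by (induction a) simp_all

lemma eval_rf_pred [simp]: "eval rf_pred [a] = Some (a - 1)"
  unfolding rf_pred_def by (induction a) simp_all

lemma eval_rf_diff [simp]: "eval rf_diff [a, b] = Some (b - a)"
  unfolding rf_diff_def by (induction a) simp_all

lemma eval_rf_dist [simp]: "eval rf_dist [a, b] = Some (b - a + (a - b))"
  unfolding rf_dist_def by simp

lemma eval_rf_prog [simp]: "eval rf_prog [n] = Some (4 * 2 ^ n - 3)"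
  unfolding rf_prog_def
proof (induction n)
  case 0
  show ?case by simp
next
  case (Suc n)
  have "Suc (Suc (Suc (4 * q - 3 + (4 * q - 3)))) = 8 * q - 3" if "1 \<le> q" for q :: nat
    using that by linarith
  from this [of "2 ^ n"] Suc show ?case by simp
qed

definition unary_machine :: machine where
  "unary_machine y p =
     (if \<exists>n. p = unary_prog n then Some (nat_str (THE n. p = unary_prog n)) else None)"

lemma unary_machine_prog [simp]: "unary_machine y (unary_prog n) = Some (nat_str n)"
proof -
  have "(THE k. unary_prog n = unary_prog k) = n"
    using unary_prog_inj by (intro the_equality) auto
  then show ?thesis by (auto simp: unary_machine_def)
qed

lemma prefix_free_unary_machine: "prefix_free_machine unary_machine"
proof -
  have step: "eval (Comp rf_dist [Comp rf_prog [Proj 0], Proj 2]) [n, a, str_nat p] = Some 0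
      \<longleftrightarrow> p = unary_prog n" for n a p
  proof -
    have "p = unary_prog n \<longleftrightarrow> str_nat p = str_nat (unary_prog n)"
      by (metis nat_str_str_nat)
    then show ?thesis by (auto simp: str_nat_unary_prog)
  qed
  have tot: "eval (Comp rf_dist [Comp rf_prog [Proj 0], Proj 2]) [n, a, b] \<noteq> None" for n a b
    by simp
  have "eval rf_unary [str_nat y, str_nat p] = map_option str_nat (unary_machine y p)" for y p
  proof (cases "\<exists>n. p = unary_prog n")
    case True
    then obtain n where n: "p = unary_prog n" by blast
    have "p = unary_prog k \<longleftrightarrow> k = n" for k
      using unary_prog_inj n by auto
    moreover have "(LEAST k. k = n) = n"
      by (rule Least_equality) simp_all
    ultimately have "eval rf_unary [str_nat y, str_nat p] = Some n"
      unfolding rf_unary_def eval.simps(6) step using tot by simp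
    with n show ?thesis by simp
  next
    case False
    then show ?thesis
      unfolding rf_unary_def eval.simps(6) step by (auto simp: unary_machine_def)
  qed
  then have "computable_machine unary_machine"
    unfolding computable_machine_def by blast
  moreover have "prefix_free {p. unary_machine y p \<noteq> None}" for y
    unfolding prefix_free_def
    by (auto simp: unary_machine_def split: if_splits dest: unary_prog_inj)
  ultimately show ?thesis by (simp add: prefix_free_machine_def)
qed

lemma universal_machine_surj:
  assumes "universal_machine U"
  shows "\<exists>p. U y p = Some x"
proof -
  have "unary_machine y (unary_prog (str_nat x)) = Some x" by simp
  with assms prefix_free_unary_machine show ?thesis
    unfolding universal_machine_def by blast
qed

lemma KP_attained:
  assumes "universal_machine U"
  shows "\<exists>p. U y p = Some x \<and> length p = KP U x y"
proof -
  have "\<exists>n p. U y p = Some x \<and> length p = n"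
    using universal_machine_surj [OF assms] by blast
  then show ?thesis unfolding KP_def by (rule LeastI_ex)
qed

lemma KP_le: "U y p = Some x \<Longrightarrow> KP U x y \<le> length p"
  unfolding KP_def by (rule Least_le) blast

lemma stoch_values_nonempty:
  assumes "universal_machine U"
  shows "stoch_values U a y \<noteq> {}"
proof -
  define W :: "str \<Rightarrow> rat" where "W = (\<lambda>b. if b = a then 1 else 0)"
  have "supp W = {a}" by (auto simp: supp_def W_def)
  then have "elementary_probability W"
    by (auto simp: elementary_probability_def W_def)
  moreover obtain v where "U y v = Some (code_measure W)"
    using universal_machine_surj [OF assms] by blast
  moreover have "deficiency U a W (code_pair v y) \<le> ereal (real 1)" for v
    by (simp add: deficiency_def W_def)
  ultimately have "real (length v) + 3 * log 2 (real 1) \<in> stoch_values U a y"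
    unfolding stoch_values_def by blast
  then show ?thesis by blast
qed

lemma finite_stoch_values_le: "finite {s \<in> stoch_values U a y. s \<le> B}"
proof -
  let ?f = "\<lambda>(j, k). real j + 3 * log 2 (real k)"
  have "s \<in> ?f ` ({..nat \<lceil>B\<rceil>} \<times> {..nat \<lceil>2 powr B\<rceil>})"
    if s: "s \<in> stoch_values U a y" "s \<le> B" for s
  proof -
    obtain j k where jk: "s = real j + 3 * log 2 (real k)" "k \<ge> 1"
      using s(1) unfolding stoch_values_def by blast
    have "log 2 (real k) \<ge> 0" using jk(2) by simp
    then have "real j \<le> B" "log 2 (real k) \<le> B" using s(2) jk(1) by linarith+
    moreover from this jk(2) have "real k \<le> 2 powr B"
      by (simp add: log_le_iff)
    ultimately have "j \<le> nat \<lceil>B\<rceil>" "k \<le> nat \<lceil>2 powr B\<rceil>" by linarith+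
    with jk(1) show ?thesis by auto
  qed
  then have "{s \<in> stoch_values U a y. s \<le> B}
      \<subseteq> ?f ` ({..nat \<lceil>B\<rceil>} \<times> {..nat \<lceil>2 powr B\<rceil>})" by blast
  then show ?thesis by (rule finite_subset) simp
qed

lemma stochasticity_attained:
  assumes "universal_machine U"
  shows "stochasticity U a y \<in> stoch_values U a y"
    and "s \<in> stoch_values U a y \<Longrightarrow> stochasticity U a y \<le> s"
proof -
  obtain s0 where s0: "s0 \<in> stoch_values U a y"
    using stoch_values_nonempty [OF assms] by blast
  define F where "F = {s \<in> stoch_values U a y. s \<le> s0}"
  have F: "finite F" "F \<noteq> {}" using finite_stoch_values_le s0 by (auto simp: F_def)
  have least: "Min F \<le> s" if "s \<in> stoch_values U a y" for s
  proof (cases "s \<le> s0")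
    case True
    with that F show ?thesis by (auto simp: F_def intro!: Min_le)
  next
    case False
    have "Min F \<le> s0" using F s0 by (auto simp: F_def intro!: Min_le)
    with False show ?thesis by simp
  qed
  have mem: "Min F \<in> stoch_values U a y" using Min_in [OF F] by (simp add: F_def)
  have "stochasticity U a y = Min F"
    unfolding stochasticity_def using mem least by (rule cInf_eq_minimum)
  with mem least show "stochasticity U a y \<in> stoch_values U a y"
    and "s \<in> stoch_values U a y \<Longrightarrow> stochasticity U a y \<le> s" by auto
qed

end

(* Let y be the code of m, let the program v of U witness the stochasticity of the code of D by a
   measure W with deficiency at most k, let s be the least integer above - log m(D), and let q be a
   shortest program for s. Call a set heavy if its m-mass is at least 2^-s. Some point of the
   support of m hits at least a 2^-s fraction of the W-weight of the heavy sets, by averaging over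
   m; so 2^L greedily chosen points miss at most weight (1 - 2^-s)^(2^L) <= 2^-(2^(L - s)). If D
   were missed, a Shannon-Fano code for the missed sets would describe D, given v and y, with about
   - log W(D) - 2^(L - s) + |q| + 2 log t bits, where t = C k encodes L through
   L = s + log t + log |q|. For a large constant C this contradicts the bound k on the deficiency.
   Hence D contains one of the chosen points, which is described by v, q, t and an index of L bits.
   The same canonical choice of points has to be found by two machines, so it is made by a total
   recursive function: the first digit string that passes a decidable test. *)

theory Submission
  imports Defs
begin

section \<open>Total recursive functionals\<close>

text \<open>Two circularities shape the construction. The number t has to beat the constant c of the
  machine that describes missed sets, although that machine works with t; therefore t is written
  into its programs, and neither machine depends on c. Likewise the length L of the index must be
  known before the index is read; it is computed from q, its output s, and t, which all precede the
  index. The coefficients of the bound follow. A self-delimiting t costs 2 log t bits and enters L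
  once more, so t costs 3 log k plus a constant, exactly the penalty in the definition of
  stochasticity; |q| + log |q| <= 2 |q| gives the 2K(s). The programs v and q need no delimiters,
  since the domain of \<open>U\<close> is prefix-free. \<open>U\<close> is partial, while the choice
  of the points must be total. Both machines are therefore specified by decidable relations with a
  stage bound for the runs of \<open>U\<close>, and one determinism condition on prefix-comparable
  programs yields both a function and a prefix-free domain.\<close>

text \<open>The arguments are read from an infinite environment. This makes weakening free, and the
  closure rules below become higher-order patterns that the method intro can apply.\<close>

definition trec :: "((nat \<Rightarrow> nat) \<Rightarrow> nat) \<Rightarrow> bool" where
  "trec f \<longleftrightarrow> (\<exists>r k. \<forall>e. eval r (map e [0..<k]) = Some (f e))"

named_theorems trec

lemma those_map_Some:
  "(\<And>x. x \<in> set xs \<Longrightarrow> f x = Some (g x)) \<Longrightarrow> those (map f xs) = Some (map g xs)"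
  by (induction xs) auto

lemma those_map_eq_None: "those (map f xs) = None \<longleftrightarrow> (\<exists>x\<in>set xs. f x = None)"
  by (induction xs) (auto split: option.splits)

lemma trec_uniform:
  assumes "trec f"
  obtains r k where "\<And>n e. n \<ge> k \<Longrightarrow> eval r (map e [0..<n]) = Some (f e)"
proof -
  obtain r k where r: "\<And>e. eval r (map e [0..<k]) = Some (f e)"
    using assms unfolding trec_def by blast
  have "eval (Comp r (map Proj [0..<k])) (map e [0..<n]) = Some (f e)" if "n \<ge> k" for n e
  proof -
    have "those (map (\<lambda>g. eval g (map e [0..<n])) (map Proj [0..<k])) = Some (map e [0..<k])"
      unfolding map_map o_def using that by (intro those_map_Some) auto
    then show ?thesis by (simp only: eval.simps bind.bind_lunit r)
  qed
  then show ?thesis using that by blast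
qed

lemma trec_var [trec]: "trec (\<lambda>e. e i)"
  unfolding trec_def by (rule exI [of _ "Proj i"], rule exI [of _ "Suc i"])
    (simp del: upt_Suc)

text \<open>Only the finitely many entries that \<open>f\<close> reads matter, so even an infinite
  family of substituted functionals needs only one finite bound on the entries read.\<close>

lemma trec_subst:
  assumes "trec f" and g: "\<And>i. trec (g i)"
  shows "trec (\<lambda>e. f (\<lambda>i. g i e))"
proof -
  obtain r k where r: "\<And>e. eval r (map e [0..<k]) = Some (f e)"
    using assms(1) unfolding trec_def by blast
  have "\<exists>q l. \<forall>n\<ge>l. \<forall>e. eval q (map e [0..<n]) = Some (g i e)" for i
    using trec_uniform [OF g [of i]] by metis
  then obtain q l where q: "\<And>i n e. n \<ge> l i \<Longrightarrow> eval (q i) (map e [0..<n]) = Some (g i e)"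
    by metis
  define n where "n = (\<Sum>i<k. l i)"
  have n: "n \<ge> l i" if "i < k" for i
    unfolding n_def using that by (intro member_le_sum) auto
  have "eval (Comp r (map q [0..<k])) (map e [0..<n]) = Some (f (\<lambda>i. g i e))" for e
  proof -
    have "those (map (\<lambda>p. eval p (map e [0..<n])) (map q [0..<k]))
        = Some (map (\<lambda>i. g i e) [0..<k])"
      unfolding map_map o_def using n by (intro those_map_Some) (auto simp: q)
    then show ?thesis by (simp only: eval.simps bind.bind_lunit r)
  qed
  then show ?thesis unfolding trec_def by blast
qed

lemma trec_shift: "trec f \<Longrightarrow> trec (\<lambda>e. f (\<lambda>n. e (n + k)))"
  by (rule trec_subst [of f "\<lambda>n e. e (n + k)"]) (simp_all add: trec_var)

text \<open>\<open>rec_nat\<close> puts the previous value into entry 1, but the body of a bounded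
  sum or search knows only its index. This inserts the unread entry.\<close>

lemma trec_skip:
  assumes "trec (\<lambda>e. h (e 0) (\<lambda>n. e (Suc n)))"
  shows "trec (\<lambda>e. h (e 0) (\<lambda>n. e (Suc (Suc n))))"
proof -
  have "trec (\<lambda>e. e (if i = 0 then 0 else Suc i))" for i :: nat by (rule trec_var)
  from trec_subst [of _ "\<lambda>i e. e (if i = 0 then 0 else Suc i)", OF assms this]
  show ?thesis by simp
qed

lemma trec_app1: "trec (\<lambda>e. F (e 0)) \<Longrightarrow> trec f \<Longrightarrow> trec (\<lambda>e. F (f e))"
  using trec_subst [of "\<lambda>e. F (e 0)" "\<lambda>i. f"] by simp

lemma trec_app2:
  assumes "trec (\<lambda>e. F (e 0) (e 1))" "trec f" "trec g"
  shows "trec (\<lambda>e. F (f e) (g e))"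
  using trec_subst [of "\<lambda>e. F (e 0) (e 1)" "\<lambda>i. if i = 0 then f else g"] assms by simp

lemma trec_app3:
  assumes "trec (\<lambda>e. F (e 0) (e 1) (e 2))" "trec f" "trec g" "trec h"
  shows "trec (\<lambda>e. F (f e) (g e) (h e))"
  using trec_subst [of "\<lambda>e. F (e 0) (e 1) (e 2)"
      "\<lambda>i. if i = 0 then f else if i = 1 then g else h"] assms
  by simp

lemma trec_Suc [trec]: "trec f \<Longrightarrow> trec (\<lambda>e. Suc (f e))"
proof (rule trec_app1 [of Suc])
  show "trec (\<lambda>e. Suc (e 0))"
    unfolding trec_def by (rule exI [of _ Succ], rule exI [of _ 1]) simp
qed

lemma trec_const [trec]: "trec (\<lambda>e. c)"
proof (induction c)
  case 0
  show ?case unfolding trec_def by (rule exI [of _ Zero]) simp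
qed (rule trec_Suc)

text \<open>Binding works as with de Bruijn indices: the step finds the counter and the previous
  value in entries 0 and 1, and the outer environment shifted by two.\<close>

lemma trec_rec [trec]:
  assumes "trec f" "trec (\<lambda>e. h (e 0) (e 1) (\<lambda>n. e (Suc (Suc n))))" "trec g"
  shows "trec (\<lambda>e. rec_nat (f e) (\<lambda>i r. h i r e) (g e))"
proof -
  let ?h = "\<lambda>e. h (e 0) (e 1) (\<lambda>n. e (Suc (Suc n)))"
  obtain q k where q: "\<And>n e. n \<ge> k \<Longrightarrow> eval q (map e [0..<n]) = Some (f e)"
    using assms(1) by (rule trec_uniform) blast
  obtain p l where p: "\<And>n e. n \<ge> l \<Longrightarrow> eval p (map e [0..<n]) = Some (?h e)"
    using assms(2) by (rule trec_uniform) blast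
  let ?K = "k + l"
  have list: "x # map e [0..<n] = map (case_nat x e) [0..<Suc n]" for x :: nat and e n
    by (rule nth_equalityI) (auto simp: nth_Cons simp del: upt_Suc split: nat.split)
  have step: "eval p (i # x # map e [0..<?K]) = Some (h i x e)" for i x e
  proof -
    have "i # x # map e [0..<?K] = map (case_nat i (case_nat x e)) [0..<Suc (Suc ?K)]"
      by (simp only: list)
    moreover have "l \<le> Suc (Suc ?K)" by simp
    note p [OF this, of "case_nat i (case_nat x e)"]
    ultimately show ?thesis by (simp add: numeral_2_eq_2 del: upt_Suc)
  qed
  have "eval (PrimRec q p) (n # map e [0..<?K]) = Some (rec_nat (f e) (\<lambda>i r. h i r e) n)" for n e
    by (induction n) (auto simp: q step)
  moreover have "map e [0..<Suc ?K] = e 0 # map (\<lambda>n. e (Suc n)) [0..<?K]" for e :: "nat \<Rightarrow> nat"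
    by (rule nth_equalityI) (auto simp: nth_Cons simp del: upt_Suc split: nat.split)
  ultimately have rec: "trec (\<lambda>e. rec_nat (f (\<lambda>n. e (Suc n))) (\<lambda>i r. h i r (\<lambda>n. e (Suc n))) (e 0))"
    unfolding trec_def by metis
  have "trec (case_nat g (\<lambda>i e. e i) i)" for i
    using assms(3) trec_var by (cases i) simp_all
  from trec_subst [of _ "case_nat g (\<lambda>i e. e i)", OF rec this] show ?thesis by simp
qed

section \<open>Closure under arithmetic, decidable predicates and bounded operators\<close>

lemma trec_add [trec]: "trec f \<Longrightarrow> trec g \<Longrightarrow> trec (\<lambda>e. f e + g e)"
proof (rule trec_app2 [of "(+)"])
  have "m + n = rec_nat m (\<lambda>_ r. Suc r) n" for m n :: nat by (induction n) auto
  then show "trec (\<lambda>e. e 0 + e 1)" by (simp only:) (intro trec)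
qed

lemma trec_mult [trec]: "trec f \<Longrightarrow> trec g \<Longrightarrow> trec (\<lambda>e. f e * g e)"
proof (rule trec_app2 [of times])
  have "m * n = rec_nat 0 (\<lambda>_ r. r + m) n" for m n :: nat by (induction n) auto
  then show "trec (\<lambda>e. e 0 * e 1)" by (simp only:) (intro trec)
qed

lemma trec_power [trec]: "trec f \<Longrightarrow> trec g \<Longrightarrow> trec (\<lambda>e. f e ^ g e)"
proof (rule trec_app2 [of "(^)"])
  have "m ^ n = rec_nat 1 (\<lambda>_ r. r * m) n" for m n :: nat by (induction n) auto
  then show "trec (\<lambda>e. e 0 ^ e 1)" by (simp only:) (intro trec)
qed

lemma trec_diff [trec]: "trec f \<Longrightarrow> trec g \<Longrightarrow> trec (\<lambda>e. f e - g e)"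
proof (rule trec_app2 [of "(-)"])
  have pred: "n - 1 = rec_nat 0 (\<lambda>i r. i) n" for n :: nat by (cases n) auto
  have "m - n = rec_nat m (\<lambda>_ r. rec_nat 0 (\<lambda>i r. i) r) n" for m n :: nat
    by (induction n) (auto simp flip: pred)
  then show "trec (\<lambda>e. e 0 - e 1)" by (simp only:) (intro trec)
qed

lemma trec_not [trec]: "trec (\<lambda>e. of_bool (P e)) \<Longrightarrow> trec (\<lambda>e. of_bool (\<not> P e))"
proof -
  assume "trec (\<lambda>e. of_bool (P e))"
  then have "trec (\<lambda>e. 1 - of_bool (P e))" by (intro trec)
  moreover have "1 - of_bool (P e) = (of_bool (\<not> P e) :: nat)" for e by simp
  ultimately show ?thesis by simp
qed

lemma trec_conj [trec]:
  "trec (\<lambda>e. of_bool (P e)) \<Longrightarrow> trec (\<lambda>e. of_bool (Q e)) \<Longrightarrow> trec (\<lambda>e. of_bool (P e \<and> Q e))"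
  unfolding of_bool_conj by (intro trec)

lemma trec_imp [trec]:
  assumes "trec (\<lambda>e. of_bool (P e))" "trec (\<lambda>e. of_bool (Q e))"
  shows "trec (\<lambda>e. of_bool (P e \<longrightarrow> Q e))"
proof -
  have "trec (\<lambda>e. of_bool (\<not> (P e \<and> \<not> Q e)))" by (intro trec assms)
  then show ?thesis by simp
qed

lemma trec_eq_0: "trec f \<Longrightarrow> trec (\<lambda>e. of_bool (f e = 0))"
proof -
  assume "trec f"
  then have "trec (\<lambda>e. 1 - f e)" by (intro trec)
  moreover have "1 - n = of_bool (n = 0)" for n :: nat by simp
  ultimately show ?thesis by simp
qed

lemma trec_le [trec]: "trec f \<Longrightarrow> trec g \<Longrightarrow> trec (\<lambda>e. of_bool (f e \<le> g e))"
  using trec_eq_0 [OF trec_diff, of f g] by simp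

lemma trec_less [trec]: "trec f \<Longrightarrow> trec g \<Longrightarrow> trec (\<lambda>e. of_bool (f e < g e))"
  unfolding not_le [symmetric] by (intro trec)

lemma trec_eq [trec]: "trec f \<Longrightarrow> trec g \<Longrightarrow> trec (\<lambda>e. of_bool (f e = g e))"
  unfolding eq_iff by (intro trec)

lemma trec_if [trec]:
  assumes "trec (\<lambda>e. of_bool (P e))" "trec f" "trec g"
  shows "trec (\<lambda>e. if P e then f e else g e)"
proof -
  have "trec (\<lambda>e. of_bool (P e) * f e + of_bool (\<not> P e) * g e)" by (intro trec assms)
  moreover have "of_bool (P e) * f e + of_bool (\<not> P e) * g e = (if P e then f e else g e)" for e
    by simp
  ultimately show ?thesis by simp
qed

lemma trec_sum [trec]:
  assumes "trec (\<lambda>e. h (e 0) (\<lambda>n. e (Suc n)))" "trec g"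
  shows "trec (\<lambda>e. \<Sum>i<g e. h i e)"
proof -
  have eq: "(\<Sum>i<n. h i e) = rec_nat 0 (\<lambda>i r. r + h i e) n" for n e by (induction n) auto
  note trec_skip [OF assms(1)]
  then show ?thesis unfolding eq using assms(2) by (intro trec)
qed

lemma trec_prod [trec]:
  assumes "trec (\<lambda>e. h (e 0) (\<lambda>n. e (Suc n)))" "trec g"
  shows "trec (\<lambda>e. \<Prod>i<g e. h i e)"
proof -
  have eq: "(\<Prod>i<n. h i e) = rec_nat 1 (\<lambda>i r. r * h i e) n" for n e by (induction n) auto
  note trec_skip [OF assms(1)]
  then show ?thesis unfolding eq using assms(2) by (intro trec)
qed

lemma trec_all [trec]:
  assumes "trec (\<lambda>e. of_bool (P (e 0) (\<lambda>n. e (Suc n))))" "trec g"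
  shows "trec (\<lambda>e. of_bool (\<forall>i<g e. P i e))"
proof -
  have "trec (\<lambda>e. \<Prod>i<g e. of_bool (P i e))" by (intro trec assms)
  moreover have "(\<Prod>i<n. of_bool (P i e)) = (of_bool (\<forall>i<n. P i e) :: nat)" for n e
    by (induction n) (auto simp: less_Suc_eq)
  ultimately show ?thesis by simp
qed

lemma trec_ex [trec]:
  assumes "trec (\<lambda>e. of_bool (P (e 0) (\<lambda>n. e (Suc n))))" "trec g"
  shows "trec (\<lambda>e. of_bool (\<exists>i<g e. P i e))"
proof -
  have "trec (\<lambda>e. of_bool (\<not> (\<forall>i<g e. \<not> P i e)))" by (intro trec assms)
  then show ?thesis by simp
qed

lemma trec_div [trec]: "trec f \<Longrightarrow> trec g \<Longrightarrow> trec (\<lambda>e. f e div g e)"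
proof (rule trec_app2 [of "(div)"])
  \<comment> \<open>The quotient counts the multiples of n up to m; the conjunct
    \<open>0 < n\<close> reproduces the convention \<open>m div 0 = 0\<close>.\<close>
  have "m div n = (\<Sum>i<m. of_bool (Suc i * n \<le> m \<and> 0 < n))" for m n :: nat
  proof (cases "n = 0")
    case False
    have "(\<Sum>i<m. of_bool (Suc i * n \<le> m \<and> 0 < n)) = card {i. i < m \<and> Suc i * n \<le> m}"
      using False by (simp add: sum.If_cases Int_def)
    also have "{i. i < m \<and> Suc i * n \<le> m} = {..<m div n}"
    proof -
      have "Suc i * n \<le> m \<longleftrightarrow> i < m div n" for i
        using False by (metis Suc_le_eq less_eq_div_iff_mult_less_eq neq0_conv)
      then have "{i. i < m \<and> Suc i * n \<le> m} = {i. i < m \<and> i < m div n}" by (simp only:)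
      also have "\<dots> = {..<m div n}" using div_le_dividend [of m n] less_le_trans by blast
      finally show ?thesis .
    qed
    finally show ?thesis by simp
  qed simp
  then show "trec (\<lambda>e. e 0 div e 1)" by (simp only:) (intro trec)
qed

lemma trec_mod [trec]: "trec f \<Longrightarrow> trec g \<Longrightarrow> trec (\<lambda>e. f e mod g e)"
  unfolding modulo_nat_def by (intro trec)

text \<open>At most one summand is nonzero, namely that of the first witness. The search is total;
  without a witness its value is 0.\<close>

definition bounded_least :: "(nat \<Rightarrow> bool) \<Rightarrow> nat \<Rightarrow> nat" where
  "bounded_least P n = (\<Sum>i<n. if P i \<and> (\<forall>j<i. \<not> P j) then i else 0)"

lemma trec_bounded_least [trec]:
  assumes "trec (\<lambda>e. of_bool (P (e 0) (\<lambda>n. e (Suc n))))" "trec g"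
  shows "trec (\<lambda>e. bounded_least (\<lambda>i. P i e) (g e))"
proof -
  note trec_skip [OF assms(1)]
  then show ?thesis unfolding bounded_least_def using assms by (intro trec)
qed

lemma bounded_least:
  assumes "P i" "i < n"
  shows "bounded_least P n = (LEAST i. P i)"
proof -
  have L: "P (LEAST i. P i)" "(LEAST i. P i) < n"
    using assms by (auto intro: LeastI Least_le le_less_trans)
  have "P i \<and> (\<forall>j<i. \<not> P j) \<longleftrightarrow> i = (LEAST i. P i)" for i
    using L(1) by (metis LeastI not_less_Least Least_le le_neq_implies_less)
  then have "bounded_least P n = (\<Sum>i<n. if i = (LEAST i. P i) then i else 0)"
    unfolding bounded_least_def by simp
  also have "\<dots> = (LEAST i. P i)" using L(2) by simp
  finally show ?thesis .
qed


section \<open>Evaluation with bounded search\<close>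

text \<open>The value is 0 for divergence and \<open>Suc z\<close> for the result \<open>z\<close>; the first argument bounds
  every unbounded search.\<close>

fun evs :: "nat \<Rightarrow> recf \<Rightarrow> nat list \<Rightarrow> nat" where
  "evs n Zero xs = 1"
| "evs n Succ xs = (case xs of [] \<Rightarrow> 0 | x # _ \<Rightarrow> Suc (Suc x))"
| "evs n (Proj i) xs = (if i < length xs then Suc (xs ! i) else 0)"
| "evs n (Comp f gs) xs =
     (if \<forall>g\<in>set gs. evs n g xs \<noteq> 0 then evs n f (map (\<lambda>g. evs n g xs - 1) gs) else 0)"
| "evs n (PrimRec f g) xs =
     (case xs of [] \<Rightarrow> 0
      | m # ys \<Rightarrow>
          rec_nat (evs n f ys) (\<lambda>i r. if r = 0 then 0 else evs n g (i # (r - 1) # ys)) m)"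
| "evs n (Mu f) xs =
     (\<Sum>i<n. if evs n f (i # xs) = 1 \<and> (\<forall>j<i. 1 < evs n f (j # xs)) then Suc i else 0)"

lemma trec_ball_list:
  "(\<And>h. h \<in> set hs \<Longrightarrow> trec (\<lambda>e. of_bool (P h e))) \<Longrightarrow> trec (\<lambda>e. of_bool (\<forall>h\<in>set hs. P h e))"
proof (induction hs)
  case Nil
  show ?case by (simp add: trec_const)
next
  case (Cons h hs)
  then have "trec (\<lambda>e. of_bool (P h e \<and> (\<forall>h\<in>set hs. P h e)))"
    by (intro trec_conj) simp_all
  then show ?case by simp
qed

text \<open>The induction needs arbitrary lists of argument functionals: composition replaces the
  list, while recursion and search put new entries in front and shift the environment.\<close>

lemma trec_evs:
  "trec g \<Longrightarrow> (\<And>f. f \<in> set fs \<Longrightarrow> trec f) \<Longrightarrow> trec (\<lambda>e. evs (g e) r (map (\<lambda>f. f e) fs))"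
proof (induction r arbitrary: g fs)
  case Zero
  then show ?case by (simp add: trec_const)
next
  case Succ
  then show ?case by (cases fs) (simp_all add: trec_const trec_Suc)
next
  case (Proj i)
  then show ?case by (cases "i < length fs") (auto intro: trec_const trec_Suc)
next
  case (Comp q qs)
  have sub: "trec (\<lambda>e. evs (g e) h (map (\<lambda>f. f e) fs))" if "h \<in> set qs" for h
    using Comp.IH(2) [OF that Comp.prems] .
  let ?ys = "map (\<lambda>h e. evs (g e) h (map (\<lambda>f. f e) fs) - 1) qs"
  have "trec f" if "f \<in> set ?ys" for f
    using that sub by (auto intro: trec_diff trec_const)
  then have "trec (\<lambda>e. evs (g e) q (map (\<lambda>f. f e) ?ys))"
    by (rule Comp.IH(1) [OF Comp.prems(1)])
  moreover have "trec (\<lambda>e. of_bool (\<forall>h\<in>set qs. evs (g e) h (map (\<lambda>f. f e) fs) \<noteq> 0))"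
    by (rule trec_ball_list) (intro trec sub)
  ultimately show ?case by (auto simp: o_def intro: trec_if trec_const)
next
  case (PrimRec p q)
  show ?case
  proof (cases fs)
    case Nil
    then show ?thesis by (simp add: trec_const)
  next
    case (Cons h hs)
    have shift: "trec (\<lambda>e. f (\<lambda>n. e (Suc (Suc n))))" if "trec f" for f
      using trec_shift [OF that, of 2] by simp
    let ?hs = "(\<lambda>e. e 0) # (\<lambda>e. e 1 - 1) # map (\<lambda>f e. f (\<lambda>n. e (Suc (Suc n)))) hs"
    have *: "trec (\<lambda>e. evs (g e) p (map (\<lambda>f. f e) hs))"
      by (rule PrimRec.IH(1) [OF PrimRec.prems(1)]) (use Cons PrimRec.prems(2) in simp)
    have "trec f" if "f \<in> set ?hs" for f
      using that PrimRec.prems(2) Cons shift trec_var by (auto intro!: trec_diff trec_const)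
    then have **: "trec (\<lambda>e. evs (g (\<lambda>n. e (Suc (Suc n)))) q (map (\<lambda>f. f e) ?hs))"
      by (rule PrimRec.IH(2) [OF shift [OF PrimRec.prems(1)]])
    then have **: "trec (\<lambda>e. evs (g (\<lambda>n. e (Suc (Suc n)))) q
        (e 0 # (e 1 - 1) # map (\<lambda>f. f (\<lambda>n. e (Suc (Suc n)))) hs))"
      by (simp add: o_def)
    let ?step = "\<lambda>i r e. if r = 0 then 0 else evs (g e) q (i # (r - 1) # map (\<lambda>f. f e) hs)"
    have "trec (\<lambda>e. if e 1 = 0 then 0
        else evs (g (\<lambda>n. e (Suc (Suc n)))) q
          (e 0 # (e 1 - 1) # map (\<lambda>f. f (\<lambda>n. e (Suc (Suc n)))) hs))"
      by (rule trec_if [OF _ _ **]) (intro trec)+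
    then have "trec (\<lambda>e. ?step (e 0) (e 1) (\<lambda>n. e (Suc (Suc n))))"
      by (simp add: o_def)
    from trec_rec [where h = ?step, OF * this] have
      "trec (\<lambda>e. rec_nat (evs (g e) p (map (\<lambda>f. f e) hs)) (\<lambda>i r. ?step i r e) (h e))"
      using PrimRec.prems(2) Cons by simp
    with Cons show ?thesis by simp
  qed
next
  case (Mu q)
  have shift: "trec (\<lambda>e. f (\<lambda>n. e (Suc n)))" if "trec f" for f
    using trec_shift [OF that, of 1] by simp
  have q: "trec (\<lambda>e. evs (g (\<lambda>n. e (Suc n))) q (e 0 # map (\<lambda>f. f (\<lambda>n. e (Suc n))) fs))"
  proof -
    let ?hs = "(\<lambda>e. e 0) # map (\<lambda>f e. f (\<lambda>n. e (Suc n))) fs"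
    have "trec (\<lambda>e. evs (g (\<lambda>n. e (Suc n))) q (map (\<lambda>f. f e) ?hs))"
      by (rule Mu.IH [OF shift [OF Mu.prems(1)]])
        (use Mu.prems(2) shift trec_var in auto)
    then show ?thesis by (simp add: o_def)
  qed
  let ?q = "\<lambda>i e. evs (g e) q (i # map (\<lambda>f. f e) fs)"
  have q': "trec (\<lambda>e. ?q (e 0) (\<lambda>n. e (Suc (Suc n))))"
    using trec_skip [of ?q, OF q] .
  have all: "trec (\<lambda>e. of_bool (\<forall>j<e 0. 1 < ?q j (\<lambda>n. e (Suc n))))"
    by (rule trec_all [where P = "\<lambda>j e. 1 < ?q j (\<lambda>n. e (Suc n))"]) (intro trec q')+
  have "trec (\<lambda>e. if ?q (e 0) (\<lambda>n. e (Suc n)) = 1 \<and> (\<forall>j<e 0. 1 < ?q j (\<lambda>n. e (Suc n)))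
      then Suc (e 0) else 0)"
    by (intro trec_if trec_conj all) (intro trec q)+
  from trec_sum [where h = "\<lambda>i e. if ?q i e = 1 \<and> (\<forall>j<i. 1 < ?q j e) then Suc i else 0", OF this Mu.prems(1)]
  show ?case by simp
qed

text \<open>\<open>R\<close> fails wherever \<open>Q\<close> holds, so at most one index
  contributes. For \<open>Mu\<close>, \<open>Q\<close> says that the value is 0 and \<open>R\<close>
  that an earlier value has been found and is positive.\<close>

lemma sum_first_eq_Suc:
  assumes "\<And>i. Q i \<Longrightarrow> \<not> R i"
  shows "(\<Sum>i<n. if Q i \<and> (\<forall>j<i. R j) then Suc i else 0) = Suc z
    \<longleftrightarrow> z < n \<and> Q z \<and> (\<forall>j<z. R j)"
proof -
  have unique: "i = j" if "Q i \<and> (\<forall>k<i. R k)" "Q j \<and> (\<forall>k<j. R k)" for i j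
    using that assms by (metis linorder_neqE_nat)
  have found: "(\<Sum>i<n. if Q i \<and> (\<forall>j<i. R j) then Suc i else 0) = Suc w"
    if "w < n" "Q w" "\<forall>j<w. R j" for w
  proof -
    have "(\<Sum>i<n. if Q i \<and> (\<forall>j<i. R j) then Suc i else 0) = (\<Sum>i<n. if i = w then Suc i else 0)"
      using unique that by (intro sum.cong) auto
    then show ?thesis using that by simp
  qed
  show ?thesis
  proof
    assume *: "(\<Sum>i<n. if Q i \<and> (\<forall>j<i. R j) then Suc i else 0) = Suc z"
    have "\<exists>w<n. Q w \<and> (\<forall>j<w. R j)"
    proof (rule ccontr)
      assume "\<not> ?thesis"
      then have "(\<Sum>i<n. if Q i \<and> (\<forall>j<i. R j) then Suc i else 0) = (0::nat)"
        by (intro sum.neutral) auto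
      with * show False by simp
    qed
    with found * show "z < n \<and> Q z \<and> (\<forall>j<z. R j)" by (metis Suc_inject)
  qed (use found in blast)
qed

lemma evs_sound: "evs n r xs = Suc z \<Longrightarrow> eval r xs = Some z"
proof (induction r arbitrary: xs z)
  case (Comp f gs)
  from Comp.prems have pos: "\<forall>g\<in>set gs. evs n g xs \<noteq> 0"
    and f: "evs n f (map (\<lambda>g. evs n g xs - 1) gs) = Suc z"
    by (auto split: if_splits)
  have "those (map (\<lambda>g. eval g xs) gs) = Some (map (\<lambda>g. evs n g xs - 1) gs)"
    using pos Comp.IH(2) by (intro those_map_Some) (metis Suc_diff_1 neq0_conv)
  with Comp.IH(1) [OF f] show ?case by simp
next
  case (PrimRec f g)
  from PrimRec.prems obtain m ys where xs: "xs = m # ys" by (cases xs) auto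
  have "rec_nat (eval f ys) (\<lambda>i r. Option.bind r (\<lambda>r. eval g (i # r # ys))) m = Some z"
    if "rec_nat (evs n f ys) (\<lambda>i r. if r = 0 then 0 else evs n g (i # (r - 1) # ys)) m = Suc z"
    for m z
    using that
  proof (induction m arbitrary: z)
    case 0
    then show ?case by (simp add: PrimRec.IH(1))
  next
    case (Suc m)
    let ?r = "rec_nat (evs n f ys) (\<lambda>i r. if r = 0 then 0 else evs n g (i # (r - 1) # ys)) m"
    from Suc.prems obtain w where "?r = Suc w" by (cases ?r) auto
    with Suc show ?case by (simp add: PrimRec.IH(2))
  qed
  with PrimRec.prems xs show ?case by simp
next
  case (Mu f)
  from Mu.prems have "z < n \<and> evs n f (z # xs) = 1 \<and> (\<forall>j<z. 1 < evs n f (j # xs))"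
    by (simp only: evs.simps) (subst (asm) sum_first_eq_Suc, auto)
  then have ev: "evs n f (z # xs) = Suc 0" "\<And>j. j < z \<Longrightarrow> 1 < evs n f (j # xs)" by auto
  have z: "eval f (z # xs) = Some 0" using Mu.IH [OF ev(1)] .
  have j: "\<exists>w. eval f (j # xs) = Some (Suc w)" if j: "j < z" for j
  proof -
    obtain w where "evs n f (j # xs) = Suc (Suc w)"
      using ev(2) [OF j] by (auto dest: less_imp_Suc_add)
    from Mu.IH [OF this] show ?thesis by blast
  qed
  have "(LEAST i. eval f (i # xs) = Some 0) = z"
  proof (rule Least_equality)
    show "z \<le> i" if "eval f (i # xs) = Some 0" for i
      using j [of i] that by (cases "i < z") auto
  qed (rule z)
  moreover have "\<exists>i. eval f (i # xs) = Some 0 \<and> (\<forall>j<i. eval f (j # xs) \<noteq> None)"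
    using z j by (intro exI [of _ z]) auto
  ultimately show ?case by simp
qed (auto split: list.splits if_splits)

text \<open>A result never changes at later stages, so finitely many subcomputations can be brought
  to a common stage; completeness rests on this.\<close>

lemma evs_mono: "evs n r xs = Suc z \<Longrightarrow> n \<le> m \<Longrightarrow> evs m r xs = Suc z"
proof (induction r arbitrary: xs z)
  case (Comp f gs)
  from Comp.prems have pos: "\<forall>g\<in>set gs. evs n g xs \<noteq> 0"
    and f: "evs n f (map (\<lambda>g. evs n g xs - 1) gs) = Suc z"
    by (auto split: if_splits)
  have eq: "evs m g xs = evs n g xs" if "g \<in> set gs" for g
    using pos Comp.IH(2) [OF that _ Comp.prems(2)] that by (metis not0_implies_Suc)
  then have "map (\<lambda>g. evs m g xs - 1) gs = map (\<lambda>g. evs n g xs - 1) gs" by simp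
  then have "evs m f (map (\<lambda>g. evs m g xs - 1) gs) = Suc z"
    using Comp.IH(1) [OF f Comp.prems(2)] by (simp only:)
  with eq pos show ?case by simp
next
  case (PrimRec f g)
  from PrimRec.prems obtain k ys where xs: "xs = k # ys" by (cases xs) auto
  have "rec_nat (evs m f ys) (\<lambda>i r. if r = 0 then 0 else evs m g (i # (r - 1) # ys)) k = Suc z"
    if "rec_nat (evs n f ys) (\<lambda>i r. if r = 0 then 0 else evs n g (i # (r - 1) # ys)) k = Suc z"
    for k z
    using that
  proof (induction k arbitrary: z)
    case 0
    then show ?case using PrimRec.IH(1) PrimRec.prems(2) by simp
  next
    case (Suc k)
    let ?r = "rec_nat (evs n f ys) (\<lambda>i r. if r = 0 then 0 else evs n g (i # (r - 1) # ys)) k"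
    from Suc.prems obtain w where "?r = Suc w" by (cases ?r) auto
    with Suc show ?case using PrimRec.IH(2) PrimRec.prems(2) by simp
  qed
  with PrimRec.prems xs show ?case by simp
next
  case (Mu f)
  from Mu.prems(1) have z: "z < n" "evs n f (z # xs) = Suc 0" "\<forall>j<z. 1 < evs n f (j # xs)"
    by (simp_all only: evs.simps) (subst (asm) sum_first_eq_Suc, auto)+
  have "evs m f (z # xs) = 1" using Mu.IH [OF z(2) Mu.prems(2)] by simp
  moreover have "1 < evs m f (j # xs)" if j: "j < z" for j
  proof -
    obtain w where "evs n f (j # xs) = Suc (Suc w)"
      using z(3) [rule_format, OF j] by (auto dest: less_imp_Suc_add)
    from Mu.IH [OF this Mu.prems(2)] show ?thesis by simp
  qed
  moreover have "z < m" using z(1) Mu.prems(2) by simp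
  ultimately show ?case
    by (simp only: evs.simps) (subst sum_first_eq_Suc, auto)
qed (auto split: list.splits if_splits)

lemma finite_uniform_stage:
  fixes P :: "nat \<Rightarrow> 'a \<Rightarrow> bool"
  assumes "finite S" "\<And>x. x \<in> S \<Longrightarrow> \<exists>n. P n x" "\<And>x n m. P n x \<Longrightarrow> n \<le> m \<Longrightarrow> P m x"
  shows "\<exists>n. \<forall>x\<in>S. P n x"
  using assms(1,2)
proof (induction S)
  case (insert x S)
  then obtain n where n: "\<forall>x\<in>S. P n x" by blast
  obtain m where "P m x" using insert.prems by blast
  with n have "\<forall>x\<in>insert x S. P (max n m) x"
    using assms(3) by (metis insert_iff max.cobounded1 max.cobounded2)
  then show ?case by blast
qed simp

lemma evs_complete: "eval r xs = Some z \<Longrightarrow> \<exists>n. evs n r xs = Suc z"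
proof (induction r arbitrary: xs z)
  case (Comp f gs)
  then obtain ys where ys: "those (map (\<lambda>g. eval g xs) gs) = Some ys" "eval f ys = Some z"
    by (auto simp: bind_eq_Some_conv)
  have def: "\<exists>y. eval g xs = Some y" if "g \<in> set gs" for g
    using ys(1) that those_map_eq_None [of "\<lambda>g. eval g xs" gs] by fastforce
  have "\<exists>n. \<forall>g\<in>set gs. \<exists>y. evs n g xs = Suc y"
  proof (rule finite_uniform_stage)
    show "\<exists>n y. evs n g xs = Suc y" if "g \<in> set gs" for g
      using def [OF that] Comp.IH(2) [OF that] by blast
    show "\<exists>y. evs m g xs = Suc y" if "\<exists>y. evs n g xs = Suc y" "n \<le> m" for g n m
      using that evs_mono by blast
  qed simp
  then obtain n where n: "\<forall>g\<in>set gs. \<exists>y. evs n g xs = Suc y" by blast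
  obtain k where k: "evs k f ys = Suc z" using Comp.IH(1) [OF ys(2)] by blast
  define m where "m = max n k"
  have g: "\<exists>y. evs m g xs = Suc y" if "g \<in> set gs" for g
    using n that evs_mono unfolding m_def by (metis max.cobounded1)
  have "those (map (\<lambda>g. eval g xs) gs) = Some (map (\<lambda>g. evs m g xs - 1) gs)"
    using g evs_sound by (intro those_map_Some) fastforce
  then have "ys = map (\<lambda>g. evs m g xs - 1) gs" using ys(1) by simp
  moreover have "evs m f ys = Suc z" using evs_mono [OF k, of m] unfolding m_def by simp
  ultimately have "evs m (Comp f gs) xs = Suc z" using g by fastforce
  then show ?case by blast
next
  case (PrimRec f g)
  from PrimRec.prems obtain m ys where xs: "xs = m # ys" by (cases xs) auto
  let ?E = "rec_nat (eval f ys) (\<lambda>i r. Option.bind r (\<lambda>r. eval g (i # r # ys)))"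
  have "\<exists>n. evs n (PrimRec f g) (m # ys) = Suc z" if "?E m = Some z" for m z
    using that
  proof (induction m arbitrary: z)
    case 0
    then show ?case using PrimRec.IH(1) by simp
  next
    case (Suc m)
    then obtain w where w: "?E m = Some w" "eval g (m # w # ys) = Some z"
      by (auto simp: bind_eq_Some_conv)
    obtain n where n: "evs n (PrimRec f g) (m # ys) = Suc w" using Suc.IH [OF w(1)] by blast
    obtain k where k: "evs k g (m # w # ys) = Suc z" using PrimRec.IH(2) [OF w(2)] by blast
    have "evs (max n k) (PrimRec f g) (m # ys) = Suc w" "evs (max n k) g (m # w # ys) = Suc z"
      using n k evs_mono by (meson max.cobounded1 max.cobounded2)+
    then have "evs (max n k) (PrimRec f g) (Suc m # ys) = Suc z" by simp
    then show ?case by blast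
  qed
  with PrimRec.prems xs show ?case by simp
next
  case (Mu f)
  let ?Z = "\<lambda>i. eval f (i # xs) = Some 0"
  from Mu.prems obtain i where i: "?Z i" "\<forall>j<i. eval f (j # xs) \<noteq> None"
    and z: "z = (LEAST i. ?Z i)"
    by (auto split: if_splits)
  have Z: "?Z z" and le: "z \<le> i" unfolding z using i(1) by (auto intro: LeastI Least_le)
  have "\<exists>n. \<forall>j\<in>{..z}. \<exists>y. evs n f (j # xs) = Suc y"
  proof (rule finite_uniform_stage)
    show "\<exists>n y. evs n f (j # xs) = Suc y" if "j \<in> {..z}" for j
    proof -
      have "eval f (j # xs) \<noteq> None" using that le i Z by (cases "j = i") auto
      then show ?thesis using Mu.IH by blast
    qed
    show "\<exists>y. evs m f (j # xs) = Suc y" if "\<exists>y. evs n f (j # xs) = Suc y" "n \<le> m" for j n m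
      using that evs_mono by blast
  qed simp
  then obtain n where n: "\<forall>j\<in>{..z}. \<exists>y. evs n f (j # xs) = Suc y" by blast
  define m where "m = max n (Suc z)"
  have m: "\<exists>y. evs m f (j # xs) = Suc y" if "j \<le> z" for j
    using n that evs_mono unfolding m_def by (metis atMost_iff max.cobounded1)
  have "evs m f (z # xs) = 1" using m [of z] evs_sound Z by fastforce
  moreover have "1 < evs m f (j # xs)" if j: "j < z" for j
  proof -
    obtain y where y: "evs m f (j # xs) = Suc y" using m [of j] j by auto
    have "\<not> ?Z j" using j unfolding z by (rule not_less_Least)
    with evs_sound [OF y] have "y \<noteq> 0" by auto
    with y show ?thesis by simp
  qed
  moreover have "z < m" unfolding m_def by simp
  ultimately have "evs m (Mu f) xs = Suc z"
    by (simp only: evs.simps) (subst sum_first_eq_Suc, auto)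
  then show ?case by blast
qed (auto split: list.splits if_splits)


section \<open>Machines from decidable relations\<close>

text \<open>The number k of entries read need not be 3. Entries beyond the third are filled with
  \<open>Zero\<close>, which cannot matter as the value depends on the first three alone.\<close>

lemma trec_eval3:
  assumes "trec (\<lambda>e. F (e 0) (e 1) (e 2))"
  shows "\<exists>r. \<forall>a b c. eval r [a, b, c] = Some (F a b c)"
proof -
  obtain r k where r: "\<And>e. eval r (map e [0..<k]) = Some (F (e 0) (e 1) (e 2))"
    using assms unfolding trec_def by blast
  have "eval (Comp r (map (\<lambda>i. if i < 3 then Proj i else Zero) [0..<k])) [a, b, c]
      = Some (F a b c)" for a b c
  proof -
    let ?xs = "[a, b, c]"
    have "those (map (\<lambda>g. eval g ?xs) (map (\<lambda>i. if i < 3 then Proj i else Zero) [0..<k]))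
        = Some (map (\<lambda>i. if i < 3 then ?xs ! i else 0) [0..<k])"
      unfolding map_map o_def by (intro those_map_Some) auto
    then have "eval (Comp r (map (\<lambda>i. if i < 3 then Proj i else Zero) [0..<k])) ?xs
        = eval r (map (\<lambda>i. if i < 3 then ?xs ! i else 0) [0..<k])"
      by (simp only: eval.simps bind.bind_lunit)
    then show ?thesis unfolding r by simp
  qed
  then show ?thesis by blast
qed

text \<open>Stage and output are searched below a common bound k. \<open>Mu h\<close> finds the
  first k that admits an output, where \<open>h\<close> is negated because \<open>Mu\<close> stops
  at 0; \<open>l\<close> then reads off the output, which \<open>single\<close> makes independent of
  the stage.\<close>

lemma machine_of_relation:
  assumes R: "trec (\<lambda>e. of_bool (R (e 0) (e 1) (e 2) (e 3)))"
    and single: "\<And>n n' y p x x'. R n y p x \<Longrightarrow> R n' y p x' \<Longrightarrow> x = x'"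
  shows "\<exists>T. computable_machine T \<and>
    (\<forall>y p x. T y p = Some x \<longleftrightarrow> (\<exists>n. R n (str_nat y) (str_nat p) (str_nat x)))"
proof -
  define Q where "Q = (\<lambda>k y p x. \<exists>n<Suc k. R n y p x)"
  have Q: "trec (\<lambda>e. of_bool (Q (e 1) (e 2) (e 3) (e 0)))"
  proof -
    \<comment> \<open>Under the binder for n the environment holds n, x, k, y, p in entries 0 to 4,
      while \<open>R\<close> expects n, y, p, x.\<close>
    have "trec (\<lambda>e. of_bool (R (e 0) (e (Suc 2)) (e (Suc 3)) (e (Suc 0))))"
      using trec_subst [OF R, of "\<lambda>i e. e (case i of 0 \<Rightarrow> 0 | Suc 0 \<Rightarrow> 3
          | Suc (Suc 0) \<Rightarrow> 4 | _ \<Rightarrow> 1)"] trec_var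
      by (simp add: numeral_2_eq_2 numeral_3_eq_3 eval_nat_numeral)
    then show ?thesis
      unfolding Q_def
      by (intro trec_ex [where P = "\<lambda>n e. R n (e 2) (e 3) (e 0)"] trec)
  qed
  have H: "trec (\<lambda>e. of_bool (\<not> (\<exists>x<Suc (e 0). Q (e 0) (e 1) (e 2) x)))"
    using Q by (intro trec_not trec_ex [where P = "\<lambda>x e. Q (e 0) (e 1) (e 2) x"] trec)
      (simp add: numeral_2_eq_2 numeral_3_eq_3)
  have L: "trec (\<lambda>e. bounded_least (\<lambda>x. Q (e 0) (e 1) (e 2) x) (Suc (e 0)))"
    using Q by (intro trec_bounded_least [where P = "\<lambda>x e. Q (e 0) (e 1) (e 2) x"] trec)
      (simp add: numeral_2_eq_2 numeral_3_eq_3)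
  obtain h where h: "\<And>k y p. eval h [k, y, p] = Some (of_bool (\<not> (\<exists>x<Suc k. Q k y p x)))"
    using trec_eval3 [of "\<lambda>k y p. of_bool (\<not> (\<exists>x<Suc k. Q k y p x))", OF H] by blast
  obtain l where l: "\<And>k y p. eval l [k, y, p] = Some (bounded_least (Q k y p) (Suc k))"
    using trec_eval3 [of "\<lambda>k y p. bounded_least (\<lambda>x. Q k y p x) (Suc k)", OF L] by blast
  define T :: machine where "T = (\<lambda>y p. if \<exists>x n. R n (str_nat y) (str_nat p) x
    then Some (nat_str (THE x. \<exists>n. R n (str_nat y) (str_nat p) x)) else None)"
  have the: "(THE x. \<exists>n. R n y p x) = x" if "R n y p x" for n y p x
    using that single by blast
  have "eval (Comp l [Mu h, Proj 0, Proj 1]) [str_nat y, str_nat p] = map_option str_nat (T y p)"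
    for y p
  proof (cases "\<exists>x n. R n (str_nat y) (str_nat p) x")
    case True
    then obtain x n where xn: "R n (str_nat y) (str_nat p) x" by blast
    let ?E = "\<lambda>k. \<exists>x<Suc k. Q k (str_nat y) (str_nat p) x"
    have "\<exists>n'<Suc (max n x). R n' (str_nat y) (str_nat p) x" "x < Suc (max n x)"
      using xn by (auto intro: le_imp_less_Suc exI [of _ n])
    then have "?E (max n x)" unfolding Q_def by blast
    then have E: "?E (LEAST k. ?E k)" by (rule LeastI)
    define k where "k = (LEAST k. ?E k)"
    have "eval (Mu h) [str_nat y, str_nat p] = Some k"
      unfolding k_def using E by (auto simp: h)
    moreover obtain x' where x': "x' < Suc k" "Q k (str_nat y) (str_nat p) x'"
      using E unfolding k_def by blast
    moreover have eq: "z = x" if "Q k (str_nat y) (str_nat p) z" for z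
      using that xn single unfolding Q_def by blast
    moreover have "(LEAST z. Q k (str_nat y) (str_nat p) z) = x"
      using eq x' by (metis LeastI)
    ultimately have "eval (Comp l [Mu h, Proj 0, Proj 1]) [str_nat y, str_nat p] = Some x"
      using bounded_least [of "Q k (str_nat y) (str_nat p)", OF x'(2,1)] by (simp del: eval.simps(6) add: l)
    with True the [OF xn] show ?thesis by (simp add: T_def del: eval.simps)
  next
    case False
    then have "eval (Mu h) [str_nat y, str_nat p] = None"
      by (auto simp: h Q_def)
    with False show ?thesis by (simp add: T_def del: eval.simps(6))
  qed
  then have "computable_machine T" unfolding computable_machine_def by blast
  moreover have "T y p = Some x \<longleftrightarrow> (\<exists>n. R n (str_nat y) (str_nat p) (str_nat x))" for y p x
    unfolding T_def using the by (auto simp: nat_str_str_nat)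
      (metis str_nat_nat_str nat_str_str_nat)+
  ultimately show ?thesis by blast
qed


section \<open>Arithmetic of strings\<close>

text \<open>\<open>Suc (str_nat x)\<close> is the number whose binary expansion is 1 followed by
  x.\<close>

lemma str_nat_bounds: "2 ^ length x \<le> Suc (str_nat x) \<and> Suc (str_nat x) < 2 ^ Suc (length x)"
  by (induction x rule: rev_induct) auto

lemma str_nat_append: "str_nat (x @ y) = str_nat x * 2 ^ length y + str_nat y"
proof (induction y rule: rev_induct)
  case (snoc b y)
  have "str_nat (x @ y @ [b]) = str_nat ((x @ y) @ [b])" by simp
  also have "\<dots> = 2 * str_nat (x @ y) + (if b then 2 else 1)" by (rule str_nat_snoc)
  finally show ?case using snoc by (simp add: algebra_simps)
qed simp

lemma str_nat_eq_iff [simp]: "str_nat x = str_nat y \<longleftrightarrow> x = y"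
  by (metis nat_str_str_nat)

lemma nat_str_eq_iff [simp]: "nat_str m = nat_str n \<longleftrightarrow> m = n"
  by (metis str_nat_nat_str)

lemma str_nat_infix_le: "str_nat x \<le> str_nat (u @ x @ v)"
proof -
  have "str_nat x * 1 \<le> str_nat x * 2 ^ length v" by (rule mult_le_mono2) simp
  then show ?thesis unfolding str_nat_append by (simp add: trans_le_add1 trans_le_add2)
qed

lemma length_le_str_nat: "length x \<le> str_nat x"
proof -
  have "Suc (length x) \<le> 2 ^ length x" by (simp add: Suc_le_eq)
  then show ?thesis using str_nat_bounds [of x] by linarith
qed

definition slen :: "nat \<Rightarrow> nat" where "slen n = length (nat_str n)"

definition scat :: "nat \<Rightarrow> nat \<Rightarrow> nat" where "scat a b = str_nat (nat_str a @ nat_str b)"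

definition scode :: "nat \<Rightarrow> nat" where "scode a = str_nat (code (nat_str a))"

lemma slen_bounds: "2 ^ slen n \<le> Suc n" "Suc n < 2 ^ Suc (slen n)"
  using str_nat_bounds [of "nat_str n"] by (simp_all add: slen_def)

lemma slen_le_log: "real (slen n) \<le> log 2 (Suc n)"
proof (rule le_log_of_power)
  show "2 ^ slen n \<le> real (Suc n)"
    using slen_bounds(1) [of n] by (metis of_nat_le_iff of_nat_numeral of_nat_power)
qed simp

lemma nat_str_scat: "nat_str (scat a b) = nat_str a @ nat_str b"
  by (simp add: scat_def)

lemma nat_str_scode: "nat_str (scode a) = code (nat_str a)"
  by (simp add: scode_def)

lemma scat_arith: "scat a b = a * 2 ^ slen b + b"
  by (simp add: scat_def slen_def str_nat_append)

lemma code_unary: "code x = unary_prog (length x) @ x"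
  by (simp add: code_def unary_prog_def)

lemma length_code: "length (code x) = 2 * length x + 1"
  by (simp add: code_def)

lemma scode_arith: "scode a = scat (4 * 2 ^ slen a - 3) a"
proof -
  have "nat_str (4 * 2 ^ slen a - 3) = unary_prog (slen a)"
    by (metis nat_str_str_nat str_nat_unary_prog)
  then show ?thesis unfolding scode_def scat_def code_unary slen_def by simp
qed

lemma trec_slen [trec]: "trec f \<Longrightarrow> trec (\<lambda>e. slen (f e))"
proof (rule trec_app1 [of slen])
  have "slen n = (\<Sum>i<n. of_bool (2 ^ Suc i \<le> Suc n))" for n
  proof -
    have "2 ^ Suc i \<le> Suc n \<longleftrightarrow> i < slen n" for i
    proof
      assume "2 ^ Suc i \<le> Suc n"
      then have "(2::nat) ^ Suc i < 2 ^ Suc (slen n)" using slen_bounds(2) [of n] by linarith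
      then show "i < slen n" by (simp del: power_Suc)
    next
      assume "i < slen n"
      then have "(2::nat) ^ Suc i \<le> 2 ^ slen n" by (intro power_increasing) auto
      then show "2 ^ Suc i \<le> Suc n" using slen_bounds(1) [of n] by linarith
    qed
    moreover have "slen n \<le> n" using length_le_str_nat [of "nat_str n"] by (simp add: slen_def)
    then have "{i. i < n \<and> i < slen n} = {..<slen n}" by auto
    ultimately show ?thesis by (simp add: sum.If_cases Int_def of_bool_def)
  qed
  then show "trec (\<lambda>e. slen (e 0))" by (simp only:) (intro trec)
qed

lemma trec_scat [trec]: "trec f \<Longrightarrow> trec g \<Longrightarrow> trec (\<lambda>e. scat (f e) (g e))"
  unfolding scat_arith by (intro trec)

lemma trec_scode [trec]: "trec f \<Longrightarrow> trec (\<lambda>e. scode (f e))"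
  unfolding scode_arith by (intro trec)

lemma code_append_cancel: "code x @ u = code y @ v \<Longrightarrow> x = y \<and> u = v"
proof -
  assume eq: "code x @ u = code y @ v"
  have pre: "prefix (unary_prog (length x)) (code x @ u)" for x u by (simp add: code_unary)
  from pre [of x u] pre [of y v] eq have "length x = length y"
    using unary_prog_inj by (metis prefix_same_cases)
  with eq show ?thesis by (simp add: code_def)
qed

lemma concat_code_inj: "concat (map code xs) = concat (map code ys) \<Longrightarrow> xs = ys"
proof (induction xs arbitrary: ys)
  case Nil
  then show ?case by (cases ys) (auto simp: code_def)
next
  case (Cons x xs)
  then obtain y zs where ys: "ys = y # zs" by (cases ys) (auto simp: code_def)
  with Cons.prems have "code x @ concat (map code xs) = code y @ concat (map code zs)" by simp
  from code_append_cancel [OF this] Cons.IH ys show ?case by simp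
qed


section \<open>Decoding\<close>

text \<open>Finite sequences are coded as base-B expansions, so that a search over sequences becomes
  a bounded search over numbers.\<close>

definition digit :: "nat \<Rightarrow> nat \<Rightarrow> nat \<Rightarrow> nat" where
  "digit e B i = e div B ^ i mod B"

lemma trec_digit [trec]:
  "trec f \<Longrightarrow> trec g \<Longrightarrow> trec h \<Longrightarrow> trec (\<lambda>e. digit (f e) (g e) (h e))"
  unfolding digit_def by (intro trec)

lemma digit_exists:
  assumes "\<And>i. i < n \<Longrightarrow> f i < B"
  shows "\<exists>e<B ^ n. \<forall>i<n. digit e B i = f i"
  using assms
proof (induction n arbitrary: f)
  case (Suc n)
  have B: "f 0 < B" using Suc.prems by simp
  obtain e where e: "e < B ^ n" "\<And>i. i < n \<Longrightarrow> digit e B i = f (Suc i)"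
    using Suc.IH [of "\<lambda>i. f (Suc i)"] Suc.prems by auto
  have "digit (f 0 + B * e) B i = f i" if "i < Suc n" for i
  proof (cases i)
    case 0
    then show ?thesis using B by (simp add: digit_def)
  next
    case (Suc j)
    have "(f 0 + B * e) div B = e" using B by simp
    then have "(f 0 + B * e) div B ^ Suc j = e div B ^ j"
      by (metis div_mult2_eq power_Suc)
    then show ?thesis using e(2) [of j] that Suc by (simp add: digit_def)
  qed
  moreover have "f 0 + B * e < B ^ Suc n"
  proof -
    have "f 0 + B * e < B * Suc e" using B by simp
    also have "\<dots> \<le> B * B ^ n" using e(1) by (intro mult_le_mono2) simp
    finally show ?thesis by simp
  qed
  ultimately show ?case by blast
qed simp

definition digits_code :: "nat \<Rightarrow> nat \<Rightarrow> nat \<Rightarrow> nat" where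
  "digits_code e B n = str_nat (concat (map (\<lambda>i. code (nat_str (digit e B i))) [0..<n]))"

lemma digits_code_rec:
  "digits_code e B n = rec_nat 0 (\<lambda>i r. scat r (scode (digit e B i))) n"
proof (induction n)
  case (Suc n)
  have "digits_code e B (Suc n) = scat (digits_code e B n) (scode (digit e B n))"
    by (simp add: digits_code_def scat_def scode_def)
  with Suc show ?case by simp
qed (simp add: digits_code_def)

lemma trec_digits_code [trec]:
  "trec f \<Longrightarrow> trec g \<Longrightarrow> trec h \<Longrightarrow> trec (\<lambda>e. digits_code (f e) (g e) (h e))"
proof (rule trec_app3 [of digits_code])
  show "trec (\<lambda>e. digits_code (e 0) (e 1) (e 2))"
    unfolding digits_code_rec by (intro trec)
qed

text \<open>Decoding inverts the encoder by exhaustive search. The bounds suffice: every item is an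
  infix of the code, so its number is at most w, and every coded item has at least one letter, so
  there are at most w of them.\<close>

definition num_items :: "nat \<Rightarrow> nat" where
  "num_items w =
     bounded_least (\<lambda>n. \<exists>e<Suc w ^ n. digits_code e (Suc w) n = w) (Suc w)"

definition items_digits :: "nat \<Rightarrow> nat" where
  "items_digits w =
     bounded_least (\<lambda>e. digits_code e (Suc w) (num_items w) = w) (Suc w ^ num_items w)"

definition item :: "nat \<Rightarrow> nat \<Rightarrow> nat" where
  "item w i = digit (items_digits w) (Suc w) i"

lemma trec_num_items [trec]: "trec f \<Longrightarrow> trec (\<lambda>e. num_items (f e))"
proof (rule trec_app1 [of num_items])
  show "trec (\<lambda>e. num_items (e 0))" unfolding num_items_def by (intro trec)
qed

lemma trec_item [trec]: "trec f \<Longrightarrow> trec g \<Longrightarrow> trec (\<lambda>e. item (f e) (g e))"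
proof (rule trec_app2 [of item])
  show "trec (\<lambda>e. item (e 0) (e 1))"
    unfolding item_def items_digits_def by (intro trec)
qed

lemma decode_items:
  fixes xs :: "str list"
  defines "w \<equiv> str_nat (concat (map code xs))"
  shows "num_items w = length xs" and "i < length xs \<Longrightarrow> item w i = str_nat (xs ! i)"
proof -
  have small: "str_nat (xs ! i) < Suc w" if i: "i < length xs" for i
  proof -
    obtain us vs where "xs = us @ xs ! i # vs"
      using id_take_nth_drop [OF i] by blast
    from arg_cong [OF this, of "\<lambda>xs. concat (map code xs)"]
    have "concat (map code xs) = concat (map code us) @ code (xs ! i) @ concat (map code vs)"
      by (simp only: map_append list.map concat_append concat.simps)
    then have "concat (map code xs)
        = (concat (map code us) @ unary_prog (length (xs ! i))) @ xs ! i @ concat (map code vs)"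
      by (simp only: code_unary append.assoc)
    then have "str_nat (xs ! i) \<le> w" unfolding w_def by (simp only: str_nat_infix_le)
    then show ?thesis by simp
  qed
  have "length xs \<le> length (concat (map code xs))"
    by (induction xs) (auto simp: length_code)
  then have len: "length xs < Suc w"
    using length_le_str_nat [of "concat (map code xs)"] unfolding w_def by simp
  have code_eq: "digits_code e (Suc w) n = w
      \<longleftrightarrow> n = length xs \<and> (\<forall>i<n. digit e (Suc w) i = str_nat (xs ! i))" for e n
  proof -
    have "digits_code e (Suc w) n = w
        \<longleftrightarrow> concat (map code (map (\<lambda>i. nat_str (digit e (Suc w) i)) [0..<n])) = concat (map code xs)"
      unfolding digits_code_def w_def str_nat_eq_iff by (simp add: o_def)
    also have "\<dots> \<longleftrightarrow> map (\<lambda>i. nat_str (digit e (Suc w) i)) [0..<n] = xs"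
      using concat_code_inj by auto
    also have "\<dots> \<longleftrightarrow> n = length xs \<and> (\<forall>i<n. nat_str (digit e (Suc w) i) = xs ! i)"
      by (auto simp: list_eq_iff_nth_eq)
    also have "\<dots> \<longleftrightarrow> n = length xs \<and> (\<forall>i<n. digit e (Suc w) i = str_nat (xs ! i))"
      by (metis nat_str_str_nat str_nat_nat_str)
    finally show ?thesis .
  qed
  obtain e where e: "e < Suc w ^ length xs" "\<forall>i<length xs. digit e (Suc w) i = str_nat (xs ! i)"
    using digit_exists [of "length xs" "\<lambda>i. str_nat (xs ! i)" "Suc w"] small by blast
  let ?P = "\<lambda>n. \<exists>e<Suc w ^ n. digits_code e (Suc w) n = w"
  have P: "?P (length xs)" using e code_eq by blast
  have "num_items w = (LEAST n. ?P n)"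
    unfolding num_items_def by (rule bounded_least [of ?P, OF P len])
  moreover have "?P (LEAST n. ?P n)" using P by (rule LeastI)
  ultimately show num: "num_items w = length xs" using code_eq by auto
  let ?Q = "\<lambda>e. digits_code e (Suc w) (length xs) = w"
  have Q: "?Q e" using e code_eq by blast
  have "items_digits w = (LEAST e. ?Q e)"
    unfolding items_digits_def num by (rule bounded_least [of ?Q, OF Q e(1)])
  moreover have "?Q (LEAST e. ?Q e)" using Q by (rule LeastI)
  ultimately have "?Q (items_digits w)" by simp
  with code_eq show "i < length xs \<Longrightarrow> item w i = str_nat (xs ! i)"
    unfolding item_def by blast
qed

text \<open>Item 0 of a coded set is its cardinality, hence \<open>0 < j\<close>.\<close>

definition item_of :: "nat \<Rightarrow> nat \<Rightarrow> bool" where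
  "item_of x a \<longleftrightarrow> (\<exists>j<num_items a. 0 < j \<and> item a j = x)"

lemma trec_item_of [trec]: "trec f \<Longrightarrow> trec g \<Longrightarrow> trec (\<lambda>e. of_bool (item_of (f e) (g e)))"
proof (rule trec_app2 [of "\<lambda>x a. of_bool (item_of x a)"])
  show "trec (\<lambda>e. of_bool (item_of (e 0) (e 1)))" unfolding item_of_def by (intro trec)
qed

lemma set_sorted_strs: "finite D \<Longrightarrow> set (sorted_strs D) = D"
  by (simp add: sorted_strs_def image_image)

lemma distinct_sorted_strs: "distinct (sorted_strs D)"
  by (simp add: sorted_strs_def distinct_map inj_on_def)

lemma length_sorted_strs: "finite D \<Longrightarrow> length (sorted_strs D) = card D"
  by (metis distinct_card distinct_sorted_strs set_sorted_strs)

lemma item_of_code_set: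
  assumes "finite D"
  shows "item_of x (str_nat (code_set D)) \<longleftrightarrow> nat_str x \<in> D"
proof -
  let ?xs = "nat_str (card D) # sorted_strs D"
  have code: "code_set D = concat (map code ?xs)" by (simp add: code_set_def)
  have "item_of x (str_nat (code_set D)) \<longleftrightarrow> (\<exists>j<length ?xs. 0 < j \<and> str_nat (?xs ! j) = x)"
    unfolding item_of_def code decode_items(1) using decode_items(2) [of _ ?xs] by metis
  also have "\<dots> \<longleftrightarrow> (\<exists>j<length (sorted_strs D). str_nat (sorted_strs D ! j) = x)"
    by (auto simp: gr0_conv_Suc)
  also have "\<dots> \<longleftrightarrow> nat_str x \<in> set (sorted_strs D)"
    unfolding in_set_conv_nth by (metis nat_str_str_nat str_nat_nat_str)
  finally show ?thesis by (simp add: set_sorted_strs assms)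
qed

text \<open>A decoded measure: the support is listed by \<open>mpoint\<close>, and all values are scaled to the
  common denominator \<open>mden\<close>.\<close>

definition mpoint :: "nat \<Rightarrow> nat \<Rightarrow> nat" where
  "mpoint w i = item w (3 * i + 1)"

text \<open>Item 0 is the size of the support; after it every point takes three items, the string,
  the numerator and the denominator. The product of the denominators is a bounded product that each
  of them divides.\<close>

definition mden :: "nat \<Rightarrow> nat" where
  "mden w = (\<Prod>i<item w 0. item w (3 * i + 3))"

definition mweight :: "nat \<Rightarrow> nat \<Rightarrow> nat" where
  "mweight w i = item w (3 * i + 2) * (mden w div item w (3 * i + 3))"

lemma trec_mpoint [trec]: "trec f \<Longrightarrow> trec g \<Longrightarrow> trec (\<lambda>e. mpoint (f e) (g e))"
  unfolding mpoint_def by (intro trec)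

lemma trec_mden [trec]: "trec f \<Longrightarrow> trec (\<lambda>e. mden (f e))"
proof (rule trec_app1 [of mden])
  show "trec (\<lambda>e. mden (e 0))" unfolding mden_def by (intro trec)
qed

lemma trec_mweight [trec]: "trec f \<Longrightarrow> trec g \<Longrightarrow> trec (\<lambda>e. mweight (f e) (g e))"
  unfolding mweight_def by (intro trec)

lemma nth_concat_triples:
  "i < length xs \<Longrightarrow> concat (map (\<lambda>a. [f a, g a, h a]) xs) ! (3 * i) = f (xs ! i)"
  "i < length xs \<Longrightarrow> concat (map (\<lambda>a. [f a, g a, h a]) xs) ! (3 * i + 1) = g (xs ! i)"
  "i < length xs \<Longrightarrow> concat (map (\<lambda>a. [f a, g a, h a]) xs) ! (3 * i + 2) = h (xs ! i)"
proof (induction xs arbitrary: i)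
  case (Cons x xs)
  { case 1 then show ?case using Cons.IH(1) [of "i - 1"] by (cases i) auto }
  { case 2 then show ?case using Cons.IH(2) [of "i - 1"] by (cases i) auto }
  { case 3 then show ?case using Cons.IH(3) [of "i - 1"] by (cases i) auto }
qed simp_all

lemma length_concat_triples: "length (concat (map (\<lambda>a. [f a, g a, h a]) xs)) = 3 * length xs"
  by (induction xs) auto

lemma decode_measure:
  assumes m: "\<And>a. m a \<ge> 0" "finite (supp m)"
  defines "w \<equiv> str_nat (code_measure m)" and "xs \<equiv> sorted_strs (supp m)"
  shows "item w 0 = length xs"
    and "i < length xs \<Longrightarrow> mpoint w i = str_nat (xs ! i)"
    and "mden w > 0"
    and "i < length xs \<Longrightarrow> real (mweight w i) = of_rat (m (xs ! i)) * real (mden w)"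
proof -
  define nu where "nu = (\<lambda>a. nat (fst (quotient_of (m a))))"
  define de where "de = (\<lambda>a. nat (snd (quotient_of (m a))))"
  define ys where "ys = nat_str (card (supp m))
    # concat (map (\<lambda>a. [a, nat_str (nu a), nat_str (de a)]) xs)"
  have code: "code_measure m = concat (map code ys)"
  proof -
    have "concat (map (\<lambda>a. code a @ code_rat (m a)) xs)
        = concat (map code (concat (map (\<lambda>a. [a, nat_str (nu a), nat_str (de a)]) xs)))"
      by (induction xs) (auto simp: code_rat_def nu_def de_def split: prod.splits)
    then show ?thesis by (simp add: code_measure_def ys_def xs_def)
  qed
  have len: "length ys = Suc (3 * length xs)"
    unfolding ys_def by (simp add: length_concat_triples del: length_concat)
  have it: "item w j = str_nat (ys ! j)" if "j < length ys" for j
    unfolding w_def code using that by (rule decode_items(2))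
  note triples = nth_concat_triples [of _ xs "\<lambda>a. a" "\<lambda>a. nat_str (nu a)" "\<lambda>a. nat_str (de a)"]
  show n: "item w 0 = length xs"
    using it [of 0] len m(2) by (simp add: ys_def xs_def length_sorted_strs)
  show "mpoint w i = str_nat (xs ! i)" if "i < length xs" for i
    unfolding mpoint_def using it [of "3 * i + 1"] len that triples(1) [OF that]
    by (simp add: ys_def)
  have num: "item w (3 * i + 2) = nu (xs ! i)" if "i < length xs" for i
    using it [of "3 * i + 2"] len that triples(2) [OF that]
    by (simp add: ys_def)
  have den: "item w (3 * i + 3) = de (xs ! i)" if "i < length xs" for i
    using it [of "3 * i + 3"] len that triples(3) [OF that]
    by (simp add: ys_def eval_nat_numeral)
  have pos: "de a > 0" for a
    using quotient_of_denom_pos' [of "m a"] by (simp add: de_def)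
  have mden: "mden w = (\<Prod>i<length xs. de (xs ! i))"
    unfolding mden_def n by (intro prod.cong) (auto simp: den)
  then show "mden w > 0" using pos by (simp add: prod_pos)
  show "real (mweight w i) = of_rat (m (xs ! i)) * real (mden w)" if "i < length xs" for i
  proof -
    have "de (xs ! i) dvd mden w"
      unfolding mden using that by (intro dvd_prodI) auto
    then obtain c where c: "mden w = de (xs ! i) * c" by blast
    then have "mden w div de (xs ! i) = c" using pos [of "xs ! i"] by simp
    moreover have "real_of_rat (m (xs ! i)) = real (nu (xs ! i)) / real (de (xs ! i))"
    proof -
      obtain a b where ab: "quotient_of (m (xs ! i)) = (a, b)" by fastforce
      then have "b > 0" by (rule quotient_of_denom_pos)
      moreover have q: "m (xs ! i) = of_int a / of_int b" using ab by (rule quotient_of_div)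
      ultimately have "a \<ge> 0" using m(1) [of "xs ! i"] by (simp add: zero_le_divide_iff)
      with \<open>b > 0\<close> show ?thesis
        unfolding nu_def de_def ab by (simp add: q of_rat_divide)
    qed
    ultimately show ?thesis
      unfolding mweight_def num [OF that] den [OF that]
      using pos [of "xs ! i"] by (simp add: c)
  qed
qed


section \<open>Shannon--Fano codewords\<close>

text \<open>The string with number \<open>z\<close> stands for the dyadic interval of all reals in \<open>[0, 1)\<close> whose
  binary expansion extends it; \<open>in_interval A B Q z\<close> says that this interval is contained in
  \<open>[A / Q, B / Q)\<close>.\<close>

definition in_interval :: "nat \<Rightarrow> nat \<Rightarrow> nat \<Rightarrow> nat \<Rightarrow> bool" where
  "in_interval A B Q z \<longleftrightarrow>
     A * 2 ^ slen z \<le> (Suc z - 2 ^ slen z) * Q \<and> (Suc (Suc z) - 2 ^ slen z) * Q \<le> B * 2 ^ slen z"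

text \<open>Maximality of the dyadic interval makes the codewords prefix-free; \<open>(z - 1) div 2\<close> is the
  number of the string without its last letter.\<close>

definition codeword :: "nat \<Rightarrow> nat \<Rightarrow> nat \<Rightarrow> nat \<Rightarrow> bool" where
  "codeword A B Q z \<longleftrightarrow>
     in_interval A B Q z \<and> (0 < z \<longrightarrow> \<not> in_interval A B Q ((z - 1) div 2))"

lemma trec_codeword [trec]:
  assumes "trec a" "trec b" "trec q" "trec z"
  shows "trec (\<lambda>e. of_bool (codeword (a e) (b e) (q e) (z e)))"
  unfolding codeword_def in_interval_def by (intro trec assms)

text \<open>\<open>Suc z\<close> reads in binary as 1 followed by the string, so subtracting
  \<open>2 ^ slen z\<close> leaves the string itself as a binary integer.\<close>

definition dyadic_left :: "nat \<Rightarrow> real" where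
  "dyadic_left z = (real (Suc z) - 2 ^ slen z) / 2 ^ slen z"

definition dyadic_right :: "nat \<Rightarrow> real" where
  "dyadic_right z = (real (Suc (Suc z)) - 2 ^ slen z) / 2 ^ slen z"

lemma in_interval_real:
  assumes "Q > 0"
  shows "in_interval A B Q z \<longleftrightarrow>
    real A / real Q \<le> dyadic_left z \<and> dyadic_right z \<le> real B / real Q"
proof -
  have le: "2 ^ slen z \<le> Suc z" "2 ^ slen z \<le> Suc (Suc z)"
    using slen_bounds(1) [of z] by simp_all
  have "in_interval A B Q z \<longleftrightarrow>
      real (A * 2 ^ slen z) \<le> real ((Suc z - 2 ^ slen z) * Q) \<and>
      real ((Suc (Suc z) - 2 ^ slen z) * Q) \<le> real (B * 2 ^ slen z)"
    unfolding in_interval_def of_nat_le_iff ..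
  also have "\<dots> \<longleftrightarrow> real A * 2 ^ slen z \<le> (real (Suc z) - 2 ^ slen z) * real Q \<and>
      (real (Suc (Suc z)) - 2 ^ slen z) * real Q \<le> real B * 2 ^ slen z"
    using le by (simp add: of_nat_diff del: of_nat_Suc)
  also have "\<dots> \<longleftrightarrow> real A / real Q \<le> dyadic_left z \<and> dyadic_right z \<le> real B / real Q"
    unfolding dyadic_left_def dyadic_right_def using assms
    by (simp add: divide_simps del: of_nat_Suc)
  finally show ?thesis .
qed

lemma dyadic_left_less_right: "dyadic_left z < dyadic_right z"
  unfolding dyadic_left_def dyadic_right_def by (simp add: divide_strict_right_mono)

lemma dyadic_prefix:
  assumes "prefix (nat_str z) (nat_str z')"
  shows "dyadic_left z \<le> dyadic_left z'" "dyadic_right z' \<le> dyadic_right z"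
proof -
  obtain u where u: "nat_str z' = nat_str z @ u" using assms by (auto simp: prefix_def)
  define k where "k = length u"
  define l where "l = slen z"
  define d where "d = str_nat u"
  have len: "slen z' = l + k" using u by (simp add: slen_def k_def l_def)
  have "z' = str_nat (nat_str z @ u)" by (metis u str_nat_nat_str)
  then have z': "z' = z * 2 ^ k + d" by (simp add: str_nat_append k_def d_def)
  have "2 ^ k \<le> Suc d" "Suc (Suc d) \<le> 2 * 2 ^ k"
    using str_nat_bounds [of u] by (simp_all add: k_def d_def)
  then have "real (2 ^ k) \<le> real (Suc d)" "real (Suc (Suc d)) \<le> real (2 * 2 ^ k)"
    by (simp_all only: of_nat_le_iff)
  then have d: "2 ^ k \<le> real d + 1" "real d + 2 \<le> 2 * 2 ^ k" by simp_all
  have l: "dyadic_left z = (real z * 2 ^ k + 2 ^ k - 2 ^ (l + k)) / 2 ^ (l + k)"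
    unfolding dyadic_left_def l_def [symmetric] by (simp add: power_add divide_simps) (simp add: algebra_simps)
  have r: "dyadic_right z = (real z * 2 ^ k + 2 * 2 ^ k - 2 ^ (l + k)) / 2 ^ (l + k)"
    unfolding dyadic_right_def l_def [symmetric] by (simp add: power_add divide_simps) (simp add: algebra_simps)
  show "dyadic_left z \<le> dyadic_left z'"
    unfolding l unfolding dyadic_left_def len unfolding z' by (rule divide_right_mono) (use d in simp_all)
  show "dyadic_right z' \<le> dyadic_right z"
    unfolding r unfolding dyadic_right_def len unfolding z' by (rule divide_right_mono) (use d in simp_all)
qed

lemma nat_str_parent: "z > 0 \<Longrightarrow> nat_str ((z - 1) div 2) = butlast (nat_str z)"
  by (subst (2) nat_str.simps) simp

text \<open>If z were a proper prefix of z', the parent of z' would still extend z, so its interval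
  would lie within that of z and hence fit. This contradicts the maximality of z'.\<close>

lemma codeword_prefix_free:
  assumes "Q > 0" "codeword A B Q z" "codeword A B Q z'" "prefix (nat_str z) (nat_str z')"
  shows "z = z'"
proof (rule ccontr)
  assume "z \<noteq> z'"
  then have strict: "strict_prefix (nat_str z) (nat_str z')"
    using assms(4) by (simp add: strict_prefix_def)
  then have "nat_str z' \<noteq> []" by auto
  then have pos: "z' > 0" by (metis gr0I nat_str_str_nat str_nat_Nil)
  let ?p = "(z' - 1) div 2"
  have "prefix (nat_str z) (nat_str ?p)"
    unfolding nat_str_parent [OF pos] using strict
    by (metis append_butlast_last_id prefix_snoc strict_prefix_def \<open>nat_str z' \<noteq> []\<close>)
  moreover have "prefix (nat_str ?p) (nat_str z')"
    unfolding nat_str_parent [OF pos] by (rule prefixeq_butlast)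
  ultimately have "in_interval A B Q ?p"
    using assms(1,2,3) dyadic_prefix unfolding codeword_def in_interval_real [OF assms(1)]
    by (meson order_trans)
  with assms(3) pos show False by (simp add: codeword_def)
qed

text \<open>The dyadic interval of the longer string is nonempty and lies in both target intervals,
  so these overlap. This separates points whose target intervals are disjoint.\<close>

lemma codeword_disjoint:
  assumes "Q > 0" "codeword A B Q z" "codeword A' B' Q z'" "prefix (nat_str z) (nat_str z')"
  shows "A' < B" "A < B'"
proof -
  have "real A / real Q \<le> dyadic_left z" "dyadic_right z \<le> real B / real Q"
    "real A' / real Q \<le> dyadic_left z'" "dyadic_right z' \<le> real B' / real Q"
    using assms(2,3) unfolding codeword_def in_interval_real [OF assms(1)] by auto
  then have "real A' / real Q < real B / real Q" "real A / real Q < real B' / real Q"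
    using dyadic_prefix [OF assms(4)] dyadic_left_less_right [of z'] by linarith+
  then show "A' < B" "A < B'" using assms(1) by (simp_all add: divide_less_cancel)
qed

lemma slen_unique: "2 ^ l \<le> Suc z \<Longrightarrow> Suc z < 2 ^ Suc l \<Longrightarrow> slen z = l"
proof (rule antisym)
  assume *: "2 ^ l \<le> Suc z" "Suc z < 2 ^ Suc l"
  have "(2::nat) ^ slen z < 2 ^ Suc l" using * slen_bounds(1) [of z] by linarith
  then show "slen z \<le> l" by (simp del: power_Suc)
  have "(2::nat) ^ l < 2 ^ Suc (slen z)" using * slen_bounds(2) [of z] by linarith
  then show "l \<le> slen z" by (simp del: power_Suc)
qed

lemma codeword_below:
  "in_interval A B Q z \<Longrightarrow> \<exists>z'. codeword A B Q z' \<and> slen z' \<le> slen z"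
proof (induction z rule: less_induct)
  case (less z)
  show ?case
  proof (cases "0 < z \<and> in_interval A B Q ((z - 1) div 2)")
    case True
    then have "(z - 1) div 2 < z" by auto
    with less.IH True obtain z' where z': "codeword A B Q z'" "slen z' \<le> slen ((z - 1) div 2)"
      by blast
    moreover have "slen ((z - 1) div 2) \<le> slen z"
    proof -
      have "slen ((z - 1) div 2) = length (butlast (nat_str z))"
        unfolding slen_def using True nat_str_parent by metis
      then show ?thesis by (simp add: slen_def)
    qed
    ultimately show ?thesis by (meson le_trans)
  next
    case False
    with less.prems show ?thesis unfolding codeword_def by blast
  qed
qed

lemma codeword_exists:
  assumes "A < B" "B \<le> Q"
  shows "\<exists>z. codeword A B Q z \<and> 2 ^ slen z * (B - A) \<le> 4 * Q"
proof -
  have Q: "Q > 0" using assms by simp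
  \<comment> \<open>An interval of length at least \<open>2 / 2 ^ l\<close> contains a dyadic
    interval of length \<open>1 / 2 ^ l\<close>. The least such l loses at most one more factor 2,
    hence the 4.\<close>
  let ?P = "\<lambda>l. 2 * Q \<le> 2 ^ l * (B - A)"
  define l where "l = (LEAST l. ?P l)"
  have "2 * Q * 1 \<le> 2 ^ (2 * Q) * (B - A)"
    using assms(1) less_exp [of "2 * Q"] by (intro mult_le_mono) linarith+
  then have P: "?P l" unfolding l_def by (intro LeastI [of ?P "2 * Q"]) simp
  have upper: "2 ^ l * (B - A) \<le> 4 * Q"
  proof (cases l)
    case 0
    then show ?thesis using assms by simp
  next
    case (Suc l')
    have "\<not> ?P l'" using Suc unfolding l_def by (metis lessI not_less_Least)
    moreover have "2 ^ l * (B - A) = 2 * (2 ^ l' * (B - A))" by (simp add: Suc)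
    ultimately show ?thesis by linarith
  qed
  \<comment> \<open>The left end point in units of \<open>1 / 2 ^ l\<close>, rounded up; the string
    sought is the binary representation of k with l digits.\<close>
  define k where "k = (A * 2 ^ l + (Q - 1)) div Q"
  have k1: "A * 2 ^ l \<le> k * Q"
  proof -
    have "A * 2 ^ l + (Q - 1) < Suc k * Q"
      unfolding k_def using Q by (metis dividend_less_div_times mult.commute mult_Suc add.commute)
    then show ?thesis using Q by simp
  qed
  have k2: "k * Q \<le> A * 2 ^ l + (Q - 1)"
    unfolding k_def by (rule div_times_less_eq_dividend)
  have "A * 2 ^ l + 2 ^ l * (B - A) = B * 2 ^ l"
    using assms(1) by (metis add.commute diff_add_inverse2 distrib_right le_add_diff_inverse2 less_imp_le mult.commute)
  then have k3: "Suc k * Q \<le> B * 2 ^ l" using k2 P by simp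
  also have "\<dots> \<le> Q * 2 ^ l" using assms(2) by simp
  finally have "Suc k * Q \<le> 2 ^ l * Q" by (simp only: mult.commute)
  then have k4: "Suc k \<le> 2 ^ l" using Q by (simp only: mult_le_cancel2)
  define z where "z = 2 ^ l + k - 1"
  have Suc_z: "Suc z = 2 ^ l + k" unfolding z_def by simp
  have len: "slen z = l"
    by (rule slen_unique) (use k4 in \<open>simp_all add: Suc_z\<close>)
  have "in_interval A B Q z"
    unfolding in_interval_def len Suc_z using k1 k3 by simp
  then obtain z' where z': "codeword A B Q z'" "slen z' \<le> slen z" using codeword_below by blast
  have "2 ^ slen z' * (B - A) \<le> 2 ^ l * (B - A)"
    using z'(2) len by (intro mult_le_mono1 power_increasing) auto
  with upper z'(1) show ?thesis by (meson le_trans)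
qed


section \<open>Hitting all heavy sets\<close>

text \<open>The greedy choice: the average over \<open>x\<close>, weighted by \<open>p\<close>, of the weight of the sets hit
  by \<open>x\<close> is at least \<open>r\<close> times the weight of all sets that are left.\<close>

lemma greedy_hitting:
  fixes p :: "'a \<Rightarrow> real" and u :: "'i \<Rightarrow> real"
  assumes S: "finite S" "S \<noteq> {}" "\<And>x. p x \<ge> 0" "sum p S \<le> 1"
    and I: "finite I" "\<And>i. u i \<ge> 0"
    and r: "r \<le> 1" "\<And>i. i \<in> I \<Longrightarrow> r \<le> sum p {x\<in>S. x \<in> E i}"
  shows "\<exists>g::nat \<Rightarrow> 'a. (\<forall>k<n. g k \<in> S) \<and>
    sum u {i\<in>I. \<forall>k<n. g k \<notin> E i} \<le> (1 - r) ^ n * sum u I"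
proof (induction n)
  case 0
  show ?case by simp
next
  case (Suc n)
  then obtain g where g: "\<forall>k<n. g k \<in> S"
    "sum u {i\<in>I. \<forall>k<n. g k \<notin> E i} \<le> (1 - r) ^ n * sum u I" by blast
  define J where "J = {i\<in>I. \<forall>k<n. g k \<notin> E i}"
  define h where "h x = sum u {i\<in>J. x \<in> E i}" for x
  have J: "finite J" "J \<subseteq> I" unfolding J_def using I(1) by auto
  obtain x where x: "x \<in> S" "\<And>y. y \<in> S \<Longrightarrow> h y \<le> h x"
    using finite_imageI [OF S(1), of h] S(2) Max_in [of "h ` S"] Max_ge [of "h ` S"]
    by (metis (no_types, lifting) imageE image_is_empty imageI)
  have "r * sum u J = (\<Sum>i\<in>J. u i * r)" by (simp add: sum_distrib_left mult.commute)
  also have "\<dots> \<le> (\<Sum>i\<in>J. u i * sum p {x\<in>S. x \<in> E i})"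
    using r(2) J(2) I(2) by (intro sum_mono mult_left_mono) auto
  also have "\<dots> = (\<Sum>i\<in>J. \<Sum>x\<in>S. if x \<in> E i then p x * u i else 0)"
    by (intro sum.cong refl) (simp add: sum_distrib_left sum.inter_filter S(1) mult.commute if_distrib cong: if_cong)
  also have "\<dots> = (\<Sum>x\<in>S. \<Sum>i\<in>J. if x \<in> E i then p x * u i else 0)"
    by (rule sum.swap)
  also have "\<dots> = (\<Sum>x\<in>S. p x * h x)"
    unfolding h_def by (intro sum.cong refl) (simp add: sum_distrib_left sum.inter_filter J(1) if_distrib cong: if_cong)
  also have "\<dots> \<le> (\<Sum>y\<in>S. p y * h x)"
    using x(2) S(3) by (intro sum_mono mult_left_mono) auto
  also have "\<dots> = sum p S * h x" by (simp add: sum_distrib_right)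
  \<comment> \<open>Total mass below 1 is harmless here, since \<open>h x\<close> is
    nonnegative.\<close>
  also have "\<dots> \<le> 1 * h x"
    using S(4) I(2) by (intro mult_right_mono) (simp_all add: h_def sum_nonneg)
  finally have hx: "r * sum u J \<le> h x" by simp
  let ?g = "g(n := x)"
  have eq: "{i\<in>I. \<forall>k<Suc n. ?g k \<notin> E i} = J - {i\<in>J. x \<in> E i}"
    unfolding J_def by (auto simp: less_Suc_eq)
  have "sum u {i\<in>I. \<forall>k<Suc n. ?g k \<notin> E i} = sum u J - h x"
    unfolding eq h_def by (rule sum_diff) (use J in auto)
  also have "\<dots> \<le> (1 - r) * sum u J" using hx by (simp add: algebra_simps)
  also have "\<dots> \<le> (1 - r) * ((1 - r) ^ n * sum u I)"
    using g(2) r(1) unfolding J_def by (intro mult_left_mono) auto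
  finally have "sum u {i\<in>I. \<forall>k<Suc n. ?g k \<notin> E i} \<le> (1 - r) ^ Suc n * sum u I" by simp
  moreover have "\<forall>k<Suc n. ?g k \<in> S" using g(1) x(1) by (simp add: less_Suc_eq)
  ultimately show ?case by blast
qed

text \<open>By \<open>1 - x \<le> exp (- x)\<close>, the power with exponent \<open>2 ^ s\<close> is
  at most 1/e and so at most 1/2; the remaining exponent is \<open>2 ^ (L - s)\<close>.\<close>

lemma power_one_minus_le:
  assumes "s \<le> L"
  shows "2 ^ (2 ^ (L - s)) * (1 - 1 / 2 ^ s) ^ (2 ^ L) \<le> (1::real)"
proof -
  have "(1 - 1 / 2 ^ s :: real) \<le> exp (- 1 / 2 ^ s)"
    using exp_ge_add_one_self [of "- 1 / 2 ^ s"] by simp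
  then have "(1 - 1 / 2 ^ s :: real) ^ (2 ^ s) \<le> exp (- 1 / 2 ^ s) ^ (2 ^ s)"
    by (intro power_mono) simp_all
  also have "\<dots> = exp (- 1)" by (simp flip: exp_of_nat_mult)
  also have "\<dots> \<le> 1 / 2"
    using exp_ge_add_one_self [of 1] by (simp add: exp_minus divide_simps)
  finally have "((1 - 1 / 2 ^ s :: real) ^ (2 ^ s)) ^ (2 ^ (L - s)) \<le> (1 / 2) ^ (2 ^ (L - s))"
    by (intro power_mono) simp_all
  moreover have "(2::nat) ^ s * 2 ^ (L - s) = 2 ^ L"
    using assms by (simp flip: power_add)
  ultimately have "(1 - 1 / 2 ^ s :: real) ^ (2 ^ L) \<le> (1 / 2) ^ (2 ^ (L - s))"
    by (metis power_mult)
  then have "2 ^ (2 ^ (L - s)) * (1 - 1 / 2 ^ s) ^ (2 ^ L) \<le> 2 ^ (2 ^ (L - s)) * (1 / 2 :: real) ^ (2 ^ (L - s))"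
    by (intro mult_left_mono) simp_all
  also have "\<dots> = 1" by (simp flip: power_mult_distrib)
  finally show ?thesis .
qed

text \<open>Below, \<open>y\<close> codes the semimeasure, \<open>w\<close> the probability measure, and \<open>e\<close> a family of
  \<open>2 ^ L\<close> strings, indexed by the strings of length \<open>L\<close> and stored as digits of \<open>e\<close> in base
  \<open>Suc y\<close>.\<close>

definition heavy :: "nat \<Rightarrow> nat \<Rightarrow> nat \<Rightarrow> bool" where
  "heavy y s a \<longleftrightarrow>
     mden y \<le> 2 ^ s * (\<Sum>i<item y 0. if item_of (mpoint y i) a then mweight y i else 0)"

text \<open>The strings of length L have the numbers from \<open>2 ^ L - 1\<close> to
  \<open>2 ^ Suc L - 2\<close>. Indexing by these numbers lets the last block of a program serve as
  the index.\<close>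

definition missed :: "nat \<Rightarrow> nat \<Rightarrow> nat \<Rightarrow> nat \<Rightarrow> bool" where
  "missed y L a e \<longleftrightarrow>
     (\<forall>i<2 ^ Suc L. slen i = L \<longrightarrow> \<not> item_of (digit e (Suc y) i) a)"

definition residual :: "nat \<Rightarrow> nat \<Rightarrow> nat \<Rightarrow> nat \<Rightarrow> nat \<Rightarrow> nat \<Rightarrow> nat" where
  "residual y w s L e i =
     (if heavy y s (mpoint w i) \<and> missed y L (mpoint w i) e then mweight w i else 0)"

definition covers :: "nat \<Rightarrow> nat \<Rightarrow> nat \<Rightarrow> nat \<Rightarrow> nat \<Rightarrow> nat \<Rightarrow> bool" where
  "covers y w s L b e \<longleftrightarrow> 2 ^ b * (\<Sum>i<item w 0. residual y w s L e i) \<le> mden w"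

text \<open>The search bound is the number of base \<open>Suc y\<close> expansions with
  \<open>2 ^ Suc L\<close> digits, one digit for each index that \<open>missed\<close>
  inspects.\<close>

definition cover :: "nat \<Rightarrow> nat \<Rightarrow> nat \<Rightarrow> nat \<Rightarrow> nat \<Rightarrow> nat" where
  "cover y w s L b = bounded_least (covers y w s L b) (Suc y ^ 2 ^ Suc L)"

lemma trec_heavy [trec]:
  "trec f \<Longrightarrow> trec g \<Longrightarrow> trec h \<Longrightarrow> trec (\<lambda>e. of_bool (heavy (f e) (g e) (h e)))"
proof (rule trec_app3 [of "\<lambda>y s a. of_bool (heavy y s a)"])
  show "trec (\<lambda>e. of_bool (heavy (e 0) (e 1) (e 2)))" unfolding heavy_def by (intro trec)
qed

lemma trec_residual:
  "trec (\<lambda>e. residual (e 0) (e 1) (e 2) (e 3) (e 4) (e 5))"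
  unfolding residual_def missed_def by (intro trec)

lemma trec_residual' [trec]:
  assumes "trec y" "trec w" "trec s" "trec L" "trec f" "trec i"
  shows "trec (\<lambda>e. residual (y e) (w e) (s e) (L e) (f e) (i e))"
  using trec_subst [OF trec_residual, of "\<lambda>n. if n = 0 then y else if n = 1 then w else
    if n = 2 then s else if n = 3 then L else if n = 4 then f else i"] assms by simp

lemma trec_cover: "trec (\<lambda>e. cover (e 0) (e 1) (e 2) (e 3) (e 4))"
  unfolding cover_def covers_def by (intro trec)

lemma trec_cover' [trec]:
  assumes "trec y" "trec w" "trec s" "trec L" "trec b"
  shows "trec (\<lambda>e. cover (y e) (w e) (s e) (L e) (b e))"
  using trec_subst [OF trec_cover, of "\<lambda>n. if n = 0 then y else if n = 1 then w else
    if n = 2 then s else if n = 3 then L else b"] assms by simp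

section \<open>Success of the bounded search for a family of points\<close>

lemma sum_nth_distinct: "distinct xs \<Longrightarrow> sum f (set xs) = (\<Sum>i<length xs. f (xs ! i))"
  using sum.reindex_bij_betw [OF bij_betw_nth [of xs "{..<length xs}" "set xs"], of f] by simp

text \<open>The greedy family, written as a digit string, passes the test below the search bound.
  Hence the least solution passes it too and \<open>cover\<close> is not a default value.\<close>

lemma cover_covers:
  assumes m: "elementary_semimeasure m" "supp m \<noteq> {}" and W: "elementary_probability W"
    and "s \<le> L"
  defines "y \<equiv> str_nat (code_measure m)" and "w \<equiv> str_nat (code_measure W)"
  shows "covers y w s L (2 ^ (L - s)) (cover y w s L (2 ^ (L - s)))"
proof -
  define xs where "xs = sorted_strs (supp m)"
  define us where "us = sorted_strs (supp W)"
  have m': "\<And>a. m a \<ge> 0" "finite (supp m)" "(\<Sum>a\<in>supp m. m a) \<le> 1"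
    using m(1) by (auto simp: elementary_semimeasure_def)
  have W': "\<And>a. W a \<ge> 0" "finite (supp W)" "(\<Sum>a\<in>supp W. W a) = 1"
    using W by (auto simp: elementary_probability_def)
  note y = decode_measure [of m, OF m'(1,2), folded y_def xs_def]
  note w = decode_measure [of W, OF W'(1,2), folded w_def us_def]
  have xs: "set xs = supp m" "distinct xs"
    using m'(2) by (simp_all add: xs_def set_sorted_strs distinct_sorted_strs)
  have us: "set us = supp W" "distinct us"
    using W'(2) by (simp_all add: us_def set_sorted_strs distinct_sorted_strs)
  define p where "p a = real_of_rat (m a)" for a
  define u where "u i = real (mweight w i) / real (mden w)" for i
  define I where "I = {i. i < item w 0 \<and> heavy y s (mpoint w i)}"
  define E where "E i = {x. item_of (str_nat x) (mpoint w i)}" for i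
  have sum_p: "sum p (supp m) \<le> 1"
  proof -
    have "sum p (supp m) = of_rat (\<Sum>a\<in>supp m. m a)" by (simp add: p_def of_rat_sum)
    also have "\<dots> \<le> of_rat 1" using m'(3) by (simp only: of_rat_less_eq)
    finally show ?thesis by simp
  qed
  have heavy_le: "1 / 2 ^ s \<le> sum p {x\<in>supp m. x \<in> E i}" if "i \<in> I" for i
  proof -
    let ?S = "\<Sum>j<item y 0. if item_of (mpoint y j) (mpoint w i) then mweight y j else 0"
    have "real (mden y) \<le> real (2 ^ s * ?S)"
      using that unfolding I_def heavy_def of_nat_le_iff by simp
    also have "real (2 ^ s * ?S) = 2 ^ s * real ?S" by simp
    also have "real ?S = (\<Sum>j<length xs. if xs ! j \<in> E i then p (xs ! j) * real (mden y) else 0)"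
      unfolding of_nat_sum y(1) by (intro sum.cong) (auto simp: E_def p_def y(2,4))
    also have "\<dots> = (\<Sum>x\<in>supp m. if x \<in> E i then p x * real (mden y) else 0)"
      unfolding xs(1) [symmetric] by (rule sum_nth_distinct [OF xs(2), symmetric])
    also have "\<dots> = sum p {x\<in>supp m. x \<in> E i} * real (mden y)"
      by (simp add: sum.inter_filter m'(2) sum_distrib_right if_distrib [of "\<lambda>x. x * _"] cong: if_cong)
    finally have "real (mden y) * 1 \<le> real (mden y) * (2 ^ s * sum p {x\<in>supp m. x \<in> E i})"
      by (simp add: algebra_simps)
    then have "1 \<le> 2 ^ s * sum p {x\<in>supp m. x \<in> E i}"
      using y(3) by (simp only: mult_le_cancel_left_pos of_nat_0_less_iff)
    then show ?thesis by (simp add: divide_simps mult.commute)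
  qed
  have sum_u: "(\<Sum>i<item w 0. u i) = 1"
  proof -
    have "(\<Sum>i<item w 0. u i) = (\<Sum>i<length us. of_rat (W (us ! i)))"
      unfolding w(1) u_def using w(3) by (intro sum.cong) (auto simp: w(4))
    also have "\<dots> = of_rat (\<Sum>a\<in>supp W. W a)"
      unfolding us(1) [symmetric] of_rat_sum by (rule sum_nth_distinct [OF us(2), symmetric])
    finally show ?thesis using W'(3) by simp
  qed
  have "\<exists>g::nat \<Rightarrow> str. (\<forall>k<2 ^ L. g k \<in> supp m) \<and>
      sum u {i\<in>I. \<forall>k<2 ^ L. g k \<notin> E i} \<le> (1 - 1 / 2 ^ s) ^ (2 ^ L) * sum u I"
    by (rule greedy_hitting [where p = p]) (use m' m(2) sum_p heavy_le in \<open>auto simp: p_def u_def I_def\<close>)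
  then obtain g :: "nat \<Rightarrow> str" where g: "\<forall>k<2 ^ L. g k \<in> supp m"
    "sum u {i\<in>I. \<forall>k<2 ^ L. g k \<notin> E i} \<le> (1 - 1 / 2 ^ s) ^ (2 ^ L) * sum u I" by blast
  \<comment> \<open>The string of length L with number i is the one at position
    \<open>Suc i - 2 ^ L\<close> of its length. At the other indices any digit below the base would
    do.\<close>
  define f where "f i = (if Suc i - 2 ^ L < 2 ^ L then str_nat (g (Suc i - 2 ^ L)) else 0)" for i
  have "f i < Suc y" for i
  proof (cases "Suc i - 2 ^ L < 2 ^ L")
    case True
    then obtain j where j: "j < length xs" "g (Suc i - 2 ^ L) = xs ! j"
      using g(1) xs(1) by (metis in_set_conv_nth)
    \<comment> \<open>Items of y are remainders modulo \<open>Suc y\<close>, so each point of the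
      support fits into one digit.\<close>
    have "mpoint y j < Suc y" unfolding mpoint_def item_def digit_def by simp
    with True j y(2) show ?thesis by (simp add: f_def)
  qed (simp add: f_def)
  then obtain e where e: "e < Suc y ^ 2 ^ Suc L" "\<forall>i<2 ^ Suc L. digit e (Suc y) i = f i"
    using digit_exists [of "2 ^ Suc L" f "Suc y"] by blast
  have hit: "\<not> item_of (str_nat (g k)) a" if "missed y L a e" "k < 2 ^ L" for a k
  proof -
    define i where "i = 2 ^ L + k - 1"
    have Suc_i: "Suc i = 2 ^ L + k" unfolding i_def by simp
    have "slen i = L" by (rule slen_unique) (use that(2) in \<open>simp_all add: Suc_i\<close>)
    moreover have "i < 2 ^ Suc L" using Suc_i that(2) by simp
    moreover have "f i = str_nat (g k)" using that(2) by (simp add: f_def Suc_i)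
    ultimately show ?thesis using that(1) e(2) unfolding missed_def by metis
  qed
  have "real (\<Sum>i<item w 0. residual y w s L e i) \<le> (\<Sum>i\<in>{i\<in>I. \<forall>k<2 ^ L. g k \<notin> E i}. real (mweight w i))"
  proof -
    have "real (\<Sum>i<item w 0. residual y w s L e i)
        \<le> (\<Sum>i<item w 0. if i \<in> I \<and> (\<forall>k<2 ^ L. g k \<notin> E i) then real (mweight w i) else 0)"
      unfolding of_nat_sum using hit
      by (intro sum_mono) (auto simp: residual_def I_def E_def)
    also have "\<dots> = (\<Sum>i\<in>{i\<in>{..<item w 0}. i \<in> I \<and> (\<forall>k<2 ^ L. g k \<notin> E i)}. real (mweight w i))"
      by (rule sum.inter_filter [symmetric]) simp
    also have "{i\<in>{..<item w 0}. i \<in> I \<and> (\<forall>k<2 ^ L. g k \<notin> E i)} = {i\<in>I. \<forall>k<2 ^ L. g k \<notin> E i}"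
      by (auto simp: I_def)
    finally show ?thesis .
  qed
  also have "\<dots> = real (mden w) * sum u {i\<in>I. \<forall>k<2 ^ L. g k \<notin> E i}"
    using w(3) by (simp add: u_def sum_distrib_left)
  also have "\<dots> \<le> real (mden w) * ((1 - 1 / 2 ^ s) ^ (2 ^ L) * 1)"
  proof -
    have "sum u I \<le> (\<Sum>i<item w 0. u i)"
      by (rule sum_mono2) (auto simp: I_def u_def)
    then have "(1 - 1 / 2 ^ s) ^ (2 ^ L) * sum u I \<le> (1 - 1 / 2 ^ s) ^ (2 ^ L) * 1"
      unfolding sum_u by (intro mult_left_mono) simp_all
    with g(2) show ?thesis by (intro mult_left_mono) linarith+
  qed
  finally have "2 ^ 2 ^ (L - s) * real (\<Sum>i<item w 0. residual y w s L e i)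
      \<le> 2 ^ 2 ^ (L - s) * (real (mden w) * ((1 - 1 / 2 ^ s) ^ (2 ^ L) * 1))"
    by (intro mult_left_mono) simp_all
  also have "\<dots> = real (mden w) * (2 ^ 2 ^ (L - s) * (1 - 1 / 2 ^ s) ^ (2 ^ L))" by simp
  also have "\<dots> \<le> real (mden w) * 1"
    by (intro mult_left_mono power_one_minus_le assms) simp
  finally have "real (2 ^ 2 ^ (L - s) * (\<Sum>i<item w 0. residual y w s L e i)) \<le> real (mden w)"
    by simp
  then have "covers y w s L (2 ^ (L - s)) e"
    unfolding covers_def of_nat_le_iff .
  from bounded_least [of "covers y w s L (2 ^ (L - s))", OF this e(1)] LeastI [of "covers y w s L (2 ^ (L - s))", OF this]
  show ?thesis unfolding cover_def by simp
qed


section \<open>The two machines\<close>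

lemma machine_stages:
  assumes "computable_machine U"
  obtains A where "trec (\<lambda>e. A (e 0) (e 1) (e 2))"
    "\<And>n y p z. A n y p = Suc z \<Longrightarrow> U (nat_str y) (nat_str p) = Some (nat_str z)"
    "\<And>y p x. U y p = Some x \<Longrightarrow> \<exists>n. \<forall>m\<ge>n. A m (str_nat y) (str_nat p) = Suc (str_nat x)"
proof -
  obtain r where r: "\<And>y p. eval r [str_nat y, str_nat p] = map_option str_nat (U y p)"
    using assms unfolding computable_machine_def by blast
  let ?A = "\<lambda>n y p. evs n r [y, p]"
  have "trec (\<lambda>e. evs (e 0) r (map (\<lambda>f. f e) [\<lambda>e. e 1, \<lambda>e. e 2]))"
    by (rule trec_evs) (auto intro: trec_var)
  then have "trec (\<lambda>e. ?A (e 0) (e 1) (e 2))" by simp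
  moreover have "U (nat_str y) (nat_str p) = Some (nat_str z)" if "?A n y p = Suc z" for n y p z
    using evs_sound [OF that] r [of "nat_str y" "nat_str p"] by (auto simp: map_option_case split: option.splits)
  moreover have "\<exists>n. \<forall>m\<ge>n. ?A m (str_nat y) (str_nat p) = Suc (str_nat x)" if x: "U y p = Some x" for y p x
  proof -
    obtain n where "evs n r [str_nat y, str_nat p] = Suc (str_nat x)"
      using evs_complete [of r "[str_nat y, str_nat p]" "str_nat x"] r [of y p] x by auto
    then show ?thesis using evs_mono by blast
  qed
  ultimately show ?thesis by (rule that)
qed

text \<open>The case \<open>p = p'\<close> of \<open>det\<close> makes the output unique, and the
  general case makes the domain prefix-free. Universality then supplies c, which depends only on
  \<open>U\<close> and \<open>R\<close>.\<close>

lemma complexity_le_of_relation: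
  assumes U: "universal_machine U"
    and R: "trec (\<lambda>e. of_bool (R (e 0) (e 1) (e 2) (e 3)))"
    and det: "\<And>n n' y p p' x x'. R n y p x \<Longrightarrow> R n' y p' x' \<Longrightarrow> prefix (nat_str p) (nat_str p')
      \<Longrightarrow> p = p' \<and> x = x'"
  shows "\<exists>c. \<forall>n y p x. R n (str_nat y) (str_nat p) (str_nat x) \<longrightarrow> KP U x y \<le> length p + c"
proof -
  have "\<exists>T. computable_machine T \<and>
    (\<forall>y p x. T y p = Some x \<longleftrightarrow> (\<exists>n. R n (str_nat y) (str_nat p) (str_nat x)))"
  proof (rule machine_of_relation [of R, OF R])
    show "x = x'" if "R n y p x" "R n' y p x'" for n n' y p x x'
      using det [OF that] by simp
  qed
  then obtain T where T: "computable_machine T"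
    "\<And>y p x. T y p = Some x \<longleftrightarrow> (\<exists>n. R n (str_nat y) (str_nat p) (str_nat x))" by blast
  have "v = w" if vw: "T y v \<noteq> None" "T y w \<noteq> None" "prefix v w" for y v w
  proof -
    obtain x x' where "T y v = Some x" "T y w = Some x'" using vw by blast
    then show ?thesis unfolding T(2) using det vw(3) by (metis nat_str_str_nat)
  qed
  then have "prefix_free_machine T"
    using T(1) unfolding prefix_free_machine_def prefix_free_def by blast
  then obtain c where c: "\<And>y p x. T y p = Some x \<Longrightarrow> \<exists>q. U y q = Some x \<and> length q \<le> length p + c"
    using U unfolding universal_machine_def by blast
  have "KP U x y \<le> length p + c" if "R n (str_nat y) (str_nat p) (str_nat x)" for n y p x
    using c [of y p x] T(2) that KP_le by (metis le_trans)
  then show ?thesis by blast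
qed

lemma prefix_code_cancel: "prefix (code x @ a) (code y @ b) \<Longrightarrow> x = y \<and> prefix a b"
proof -
  assume "prefix (code x @ a) (code y @ b)"
  then obtain u where "code y @ b = code x @ (a @ u)" by (auto simp: prefix_def)
  from code_append_cancel [OF this] show ?thesis by simp
qed

text \<open>Here \<open>2 ^ (s + h)\<close> strings are chosen, which leaves a fraction of at most \<open>2 ^ - 2 ^ h\<close> of the
  weight of \<open>w\<close> to missed sets; scaling by \<open>2 ^ 2 ^ h\<close> turns the rest into at most one.\<close>

definition chosen :: "nat \<Rightarrow> nat \<Rightarrow> nat \<Rightarrow> nat \<Rightarrow> nat" where
  "chosen y w s h = cover y w s (s + h) (2 ^ h)"

text \<open>Over the denominator \<open>mden w\<close>, consecutive values bound the Shannon--Fano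
  interval of the i-th point. A point without residual weight gets an empty interval and hence no
  codeword.\<close>

definition cumulative :: "nat \<Rightarrow> nat \<Rightarrow> nat \<Rightarrow> nat \<Rightarrow> nat \<Rightarrow> nat" where
  "cumulative y w s h i = 2 ^ 2 ^ h * (\<Sum>j<i. residual y w s (s + h) (chosen y w s h) j)"

lemma cumulative_Suc:
  "cumulative y w s h (Suc i)
    = cumulative y w s h i + 2 ^ 2 ^ h * residual y w s (s + h) (chosen y w s h) i"
  by (simp add: cumulative_def algebra_simps)

lemma cumulative_mono: "i \<le> j \<Longrightarrow> cumulative y w s h i \<le> cumulative y w s h j"
  unfolding cumulative_def by (intro mult_le_mono2 sum_mono2) auto

lemma trec_chosen [trec]:
  "trec y \<Longrightarrow> trec w \<Longrightarrow> trec s \<Longrightarrow> trec h \<Longrightarrow> trec (\<lambda>e. chosen (y e) (w e) (s e) (h e))"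
  unfolding chosen_def by (intro trec)

lemma trec_cumulative: "trec (\<lambda>e. cumulative (e 0) (e 1) (e 2) (e 3) (e 4))"
  unfolding cumulative_def by (intro trec)

lemma trec_cumulative' [trec]:
  assumes "trec y" "trec w" "trec s" "trec h" "trec i"
  shows "trec (\<lambda>e. cumulative (y e) (w e) (s e) (h e) (i e))"
  using trec_subst [OF trec_cumulative, of "\<lambda>n. if n = 0 then y else if n = 1 then w else
    if n = 2 then s else if n = 3 then h else i"] assms by simp

text \<open>This is about log t + log |q|, with q given by its number: its power of 2 is of the
  order of (t + 1)(|q| + 1). Being computable from t and q, it costs no program bits of its
  own.\<close>

definition index_length :: "nat \<Rightarrow> nat \<Rightarrow> nat" where
  "index_length t q = slen t + slen (slen q)"

lemma trec_index_length [trec]: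
  "trec f \<Longrightarrow> trec g \<Longrightarrow> trec (\<lambda>e. index_length (f e) (g e))"
  unfolding index_length_def by (intro trec)

locale staged_machine =
  fixes U :: machine and A :: "nat \<Rightarrow> nat \<Rightarrow> nat \<Rightarrow> nat"
  assumes trec_stage: "trec (\<lambda>e. A (e 0) (e 1) (e 2))"
    and stage_sound: "A n y p = Suc z \<Longrightarrow> U (nat_str y) (nat_str p) = Some (nat_str z)"
    and stage_complete:
      "U \<alpha> v = Some x \<Longrightarrow> \<exists>n. \<forall>m\<ge>n. A m (str_nat \<alpha>) (str_nat v) = Suc (str_nat x)"
    and prefix_free: "prefix_free {v. U \<alpha> v \<noteq> None}"
begin

lemmas trec_A [trec] = trec_app3 [of A, OF trec_stage]

text \<open>Halting programs of \<open>U\<close> can be split off the front without delimiters: two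
  that begin the same string are comparable, hence equal. The stages then agree because each shows
  the true output.\<close>

lemma stage_cancel:
  assumes "A n y v \<noteq> 0" "A n' y v' \<noteq> 0" "prefix (nat_str v @ a) (nat_str v' @ a')"
  shows "v = v' \<and> A n y v = A n' y v' \<and> prefix a a'"
proof -
  obtain z z' where z: "A n y v = Suc z" "A n' y v' = Suc z'"
    using assms(1,2) not0_implies_Suc by blast
  note sound = stage_sound [OF z(1)] stage_sound [OF z(2)]
  have "prefix (nat_str v) (nat_str v' @ a')" "prefix (nat_str v') (nat_str v' @ a')"
    using assms(3) by (auto simp: prefix_def)
  then have "prefix (nat_str v) (nat_str v') \<or> prefix (nat_str v') (nat_str v)"
    by (rule prefix_same_cases)
  moreover have "nat_str v = nat_str v'" if "prefix (nat_str v) (nat_str v')"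
    using prefix_free [of "nat_str y"] sound that unfolding prefix_free_def by blast
  moreover have "nat_str v' = nat_str v" if "prefix (nat_str v') (nat_str v)"
    using prefix_free [of "nat_str y"] sound that unfolding prefix_free_def by blast
  ultimately have "nat_str v = nat_str v'" by metis
  then have "v = v'" by simp
  with assms(3) z sound show ?thesis by auto
qed

text \<open>Programs \<open>v q \<langle>t\<rangle> z\<close>: here \<open>v\<close> produces the measure \<open>w\<close>, \<open>q\<close> produces \<open>s\<close>, and \<open>z\<close> is an
  index of one of the chosen strings.\<close>

definition index_relation :: "nat \<Rightarrow> nat \<Rightarrow> nat \<Rightarrow> nat \<Rightarrow> bool" where
  "index_relation n y p x \<longleftrightarrow>
     (\<exists>v<Suc p. \<exists>q<Suc p. \<exists>t<Suc p. \<exists>z<Suc p.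
        p = scat v (scat q (scat (scode t) z)) \<and> A n y v \<noteq> 0 \<and> A n y q \<noteq> 0 \<and>
        slen z = (A n y q - 1) + index_length t q \<and>
        x = digit (chosen y (A n y v - 1) (A n y q - 1) (index_length t q)) (Suc y) z)"

lemma trec_index_relation: "trec (\<lambda>e. of_bool (index_relation (e 0) (e 1) (e 2) (e 3)))"
  unfolding index_relation_def by (intro trec)

text \<open>The blocks v, q and the code of t are split off in turn. They determine the length of
  the index, so the last blocks are comparable strings of equal length.\<close>

lemma index_relation_det:
  assumes "index_relation n y p x" "index_relation n' y p' x'" "prefix (nat_str p) (nat_str p')"
  shows "p = p' \<and> x = x'"
proof -
  from assms(1) obtain v q t z where 1:
    "p = scat v (scat q (scat (scode t) z))" "A n y v \<noteq> 0" "A n y q \<noteq> 0"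
    "slen z = (A n y q - 1) + index_length t q"
    "x = digit (chosen y (A n y v - 1) (A n y q - 1) (index_length t q)) (Suc y) z"
    unfolding index_relation_def by blast
  from assms(2) obtain v' q' t' z' where 2:
    "p' = scat v' (scat q' (scat (scode t') z'))" "A n' y v' \<noteq> 0" "A n' y q' \<noteq> 0"
    "slen z' = (A n' y q' - 1) + index_length t' q'"
    "x' = digit (chosen y (A n' y v' - 1) (A n' y q' - 1) (index_length t' q')) (Suc y) z'"
    unfolding index_relation_def by blast
  have "prefix (nat_str v @ nat_str q @ code (nat_str t) @ nat_str z)
      (nat_str v' @ nat_str q' @ code (nat_str t') @ nat_str z')"
    using assms(3) by (simp add: 1(1) 2(1) nat_str_scat nat_str_scode)
  from stage_cancel [OF 1(2) 2(2) this]
  have v: "v = v'" "A n y v = A n' y v'"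
    and "prefix (nat_str q @ code (nat_str t) @ nat_str z) (nat_str q' @ code (nat_str t') @ nat_str z')"
    by blast+
  from stage_cancel [OF 1(3) 2(3) this(3)]
  have q: "q = q'" "A n y q = A n' y q'"
    and "prefix (code (nat_str t) @ nat_str z) (code (nat_str t') @ nat_str z')" by blast+
  from prefix_code_cancel [OF this(3)] have t: "t = t'" and "prefix (nat_str z) (nat_str z')"
    by simp_all
  moreover have "length (nat_str z) = length (nat_str z')"
    using 1(4) 2(4) q t by (simp add: slen_def)
  ultimately have "nat_str z = nat_str z'" by (auto simp: prefix_def)
  then have "z = z'" by simp
  with 1 2 v q t show ?thesis by simp
qed

text \<open>Programs \<open>q \<langle>t\<rangle> z\<close> with \<open>\<langle>v, y\<rangle>\<close> on the auxiliary tape: here \<open>z\<close> is the Shannon--Fano codeword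
  of a point of \<open>w\<close> for the residual weights.\<close>

definition residual_relation :: "nat \<Rightarrow> nat \<Rightarrow> nat \<Rightarrow> nat \<Rightarrow> bool" where
  "residual_relation n k p x \<longleftrightarrow>
     (\<exists>q<Suc p. \<exists>t<Suc p. \<exists>z<Suc p.
        p = scat q (scat (scode t) z) \<and> A n (item k 1) (item k 0) \<noteq> 0 \<and> A n (item k 1) q \<noteq> 0 \<and>
        0 < mden (A n (item k 1) (item k 0) - 1) \<and>
        (\<exists>i<item (A n (item k 1) (item k 0) - 1) 0.
           codeword
             (cumulative (item k 1) (A n (item k 1) (item k 0) - 1) (A n (item k 1) q - 1)
               (index_length t q) i)
             (cumulative (item k 1) (A n (item k 1) (item k 0) - 1) (A n (item k 1) q - 1)
               (index_length t q) (Suc i))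
             (mden (A n (item k 1) (item k 0) - 1)) z \<and>
           x = mpoint (A n (item k 1) (item k 0) - 1) i))"

lemma trec_residual_relation: "trec (\<lambda>e. of_bool (residual_relation (e 0) (e 1) (e 2) (e 3)))"
  unfolding residual_relation_def by (intro trec)

text \<open>Once q and t agree, both last blocks are codewords for members of one partition.
  Comparable codewords have overlapping intervals, which forces the same member and then the same
  codeword.\<close>

lemma residual_relation_det:
  assumes "residual_relation n k p x" "residual_relation n' k p' x'"
    and "prefix (nat_str p) (nat_str p')"
  shows "p = p' \<and> x = x'"
proof -
  define y v where "y = item k 1" and "v = item k 0"
  from assms(1) obtain q t z i where 1:
    "p = scat q (scat (scode t) z)" "A n y v \<noteq> 0" "A n y q \<noteq> 0" "0 < mden (A n y v - 1)"
    "codeword (cumulative y (A n y v - 1) (A n y q - 1) (index_length t q) i)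
      (cumulative y (A n y v - 1) (A n y q - 1) (index_length t q) (Suc i)) (mden (A n y v - 1)) z"
    "x = mpoint (A n y v - 1) i"
    unfolding residual_relation_def y_def v_def by blast
  from assms(2) obtain q' t' z' i' where 2:
    "p' = scat q' (scat (scode t') z')" "A n' y v \<noteq> 0" "A n' y q' \<noteq> 0"
    "codeword (cumulative y (A n' y v - 1) (A n' y q' - 1) (index_length t' q') i')
      (cumulative y (A n' y v - 1) (A n' y q' - 1) (index_length t' q') (Suc i')) (mden (A n' y v - 1)) z'"
    "x' = mpoint (A n' y v - 1) i'"
    unfolding residual_relation_def y_def v_def by blast
  have w: "A n y v = A n' y v" using stage_cancel [OF 1(2) 2(2), of "[]" "[]"] by simp
  have "prefix (nat_str q @ code (nat_str t) @ nat_str z) (nat_str q' @ code (nat_str t') @ nat_str z')"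
    using assms(3) by (simp add: 1(1) 2(1) nat_str_scat nat_str_scode)
  from stage_cancel [OF 1(3) 2(3) this]
  have q: "q = q'" "A n y q = A n' y q'"
    and "prefix (code (nat_str t) @ nat_str z) (code (nat_str t') @ nat_str z')" by blast+
  from prefix_code_cancel [OF this(3)] have t: "t = t'" and pre: "prefix (nat_str z) (nat_str z')"
    by simp_all
  define cum where "cum = cumulative y (A n y v - 1) (A n y q - 1) (index_length t q)"
  have c: "codeword (cum i) (cum (Suc i)) (mden (A n y v - 1)) z"
    "codeword (cum i') (cum (Suc i')) (mden (A n y v - 1)) z'"
    using 1(5) 2(4) w q t by (simp_all add: cum_def)
  have mono: "cum a \<le> cum b" if "a \<le> b" for a b
    unfolding cum_def using that by (rule cumulative_mono)
  have "i' < Suc i" "i < Suc i'"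
    using codeword_disjoint [OF 1(4) c pre] mono by (meson leD leI)+
  then have "i = i'" by simp
  moreover from this c have "z = z'" using codeword_prefix_free [OF 1(4) _ _ pre] by simp
  ultimately show ?thesis using 1(1,6) 2(1,5) w q t by simp
qed

end

section \<open>Size estimates for the blocks of a program\<close>

lemma le_scat: "a \<le> scat a b" "b \<le> scat a b"
  using str_nat_infix_le [of "nat_str a" "[]" "nat_str b"]
    str_nat_infix_le [of "nat_str b" "nat_str a" "[]"]
  by (simp_all add: scat_def)

lemma le_scode: "a \<le> scode a"
  by (simp add: scode_arith le_scat)

lemma slen_le: "slen n \<le> n"
  using length_le_str_nat [of "nat_str n"] by (simp add: slen_def)

text \<open>This is the inequality that contradicts the deficiency bound. The 4 collects 2 bits for
  the factor 4 in \<open>codeword_exists\<close>, 1 for the floor in the deficiency and 1 for the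
  delimiter in the code of t.\<close>

lemma index_length_large:
  assumes "k \<ge> 1" and "t = 4 * (5 + c) * k"
  shows "k + l + 2 * slen t + 4 + c < 2 ^ (slen t + slen l)"
proof -
  define a where "a = slen t"
  obtain j where "k = Suc j" using assms(1) by (cases k) auto
  \<comment> \<open>Let X be \<open>2 ^ slen t\<close>. Since k is positive, 5 + c in t yields k + 4
    + c, and the factor 4 lets half of X exceed this sum; the other half absorbs
    \<open>2 * slen t\<close>. From \<open>t \<ge> 20\<close> follows \<open>slen t \<ge> 4\<close>,
    where \<open>4 * a \<le> 2 ^ a\<close> begins to hold.\<close>
  then have t: "4 * (k + 4 + c) \<le> t" "20 \<le> t"
    unfolding assms(2) by (simp_all add: algebra_simps)
  have "t + 2 \<le> 2 * 2 ^ a" "l + 2 \<le> 2 * 2 ^ slen l"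
    using slen_bounds(2) [of t] slen_bounds(2) [of l] by (simp_all add: a_def)
  have "\<not> a \<le> 3"
  proof
    assume "a \<le> 3"
    then have "(2::nat) ^ a \<le> 2 ^ 3" by (intro power_increasing) auto
    with \<open>t + 2 \<le> 2 * 2 ^ a\<close> t(2) show False by simp
  qed
  then have a: "4 \<le> a" by simp
  then have "4 * a \<le> 2 ^ a"
  proof (induction a rule: dec_induct)
    case (step n)
    then show ?case by simp
  qed simp
  have "2 * l + 2 * 2 ^ a \<le> 2 ^ a * (l + 2)"
  proof -
    have "2 * l \<le> 2 ^ a * l" using \<open>4 * a \<le> 2 ^ a\<close> a by (intro mult_le_mono1) simp
    then show ?thesis by (simp add: algebra_simps)
  qed
  also have "\<dots> \<le> 2 ^ a * (2 * 2 ^ slen l)"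
    using \<open>l + 2 \<le> 2 * 2 ^ slen l\<close> by (rule mult_le_mono2)
  also have "\<dots> = 2 * 2 ^ (a + slen l)" by (simp add: power_add)
  finally have *: "2 * l + 2 * 2 ^ a \<le> 2 * 2 ^ (a + slen l)" .
  have "k + l + 2 * a + 4 + c < P"
    if "2 * l + 2 * X \<le> 2 * P" "t + 2 \<le> 2 * X" "4 * a \<le> X" for X P
    using that t(1) by simp
  from this [OF * \<open>t + 2 \<le> 2 * 2 ^ a\<close> \<open>4 * a \<le> 2 ^ a\<close>] show ?thesis by (simp add: a_def)
qed


section \<open>The complexity bound\<close>

lemma heavy_code_set:
  assumes "elementary_semimeasure m" "finite D" "1 / 2 ^ s \<le> real_of_rat (\<Sum>x\<in>D. m x)"
  shows "heavy (str_nat (code_measure m)) s (str_nat (code_set D))"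
proof -
  define y where "y = str_nat (code_measure m)"
  define xs where "xs = sorted_strs (supp m)"
  have m: "\<And>a. m a \<ge> 0" "finite (supp m)"
    using assms(1) by (auto simp: elementary_semimeasure_def)
  note dec = decode_measure [of m, OF m, folded y_def xs_def]
  have xs: "set xs = supp m" "distinct xs"
    using m(2) by (simp_all add: xs_def set_sorted_strs distinct_sorted_strs)
  let ?S = "\<Sum>i<item y 0. if item_of (mpoint y i) (str_nat (code_set D)) then mweight y i else 0"
  have "real ?S = (\<Sum>j<length xs. if xs ! j \<in> D then of_rat (m (xs ! j)) * real (mden y) else 0)"
    unfolding of_nat_sum dec(1)
    by (intro sum.cong) (auto simp: item_of_code_set [OF assms(2)] dec(2,4))
  also have "\<dots> = (\<Sum>x\<in>supp m. if x \<in> D then of_rat (m x) * real (mden y) else 0)"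
    unfolding xs(1) [symmetric] by (rule sum_nth_distinct [OF xs(2), symmetric])
  also have "\<dots> = (\<Sum>x\<in>supp m \<inter> D. of_rat (m x) * real (mden y))"
    by (rule sum.inter_restrict [OF m(2), symmetric])
  also have "\<dots> = (\<Sum>x\<in>D. of_rat (m x) * real (mden y))"
    using assms(2) by (intro sum.mono_neutral_left) (auto simp: supp_def)
  also have "\<dots> = of_rat (\<Sum>x\<in>D. m x) * real (mden y)"
    by (simp add: of_rat_sum sum_distrib_right)
  finally have S: "real ?S = of_rat (\<Sum>x\<in>D. m x) * real (mden y)" .
  have "1 \<le> 2 ^ s * real_of_rat (\<Sum>x\<in>D. m x)" using assms(3) by (simp add: divide_simps mult.commute)
  then have "1 * real (mden y) \<le> 2 ^ s * real_of_rat (\<Sum>x\<in>D. m x) * real (mden y)"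
    by (rule mult_right_mono) simp
  then have "real (mden y) \<le> real (2 ^ s * ?S)"
    unfolding of_nat_mult S by (simp add: mult.assoc)
  then show ?thesis unfolding heavy_def y_def [symmetric] of_nat_le_iff .
qed


context staged_machine
begin

lemma index_relationI:
  assumes v: "U y v = Some w" and q: "U y q = Some (nat_str s)"
    and z: "slen z = s + index_length t (str_nat q)"
  shows "\<exists>n. index_relation n (str_nat y) (str_nat (v @ q @ code (nat_str t) @ nat_str z))
    (digit (chosen (str_nat y) (str_nat w) s (index_length t (str_nat q))) (Suc (str_nat y)) z)"
proof -
  obtain n n' where "\<forall>k\<ge>n. A k (str_nat y) (str_nat v) = Suc (str_nat w)"
    "\<forall>k\<ge>n'. A k (str_nat y) (str_nat q) = Suc s"
    using stage_complete [OF v] stage_complete [OF q] by auto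
  then have A: "A (max n n') (str_nat y) (str_nat v) = Suc (str_nat w)"
    "A (max n n') (str_nat y) (str_nat q) = Suc s" by simp_all
  let ?p = "scat (str_nat v) (scat (str_nat q) (scat (scode t) z))"
  have p: "str_nat (v @ q @ code (nat_str t) @ nat_str z) = ?p"
    by (simp add: scat_def scode_def)
  \<comment> \<open>Every block is an infix of the program or of its code there, so the quantifier
    bounds that make the relation decidable hold.\<close>
  have "str_nat v < Suc ?p" "str_nat q < Suc ?p" "t < Suc ?p" "z < Suc ?p"
    using le_scat le_scode unfolding less_Suc_eq_le by (meson le_trans)+
  then have "index_relation (max n n') (str_nat y) ?p
    (digit (chosen (str_nat y) (str_nat w) s (index_length t (str_nat q))) (Suc (str_nat y)) z)"
    unfolding index_relation_def
    by (intro exI [of _ "str_nat v"] exI [of _ "str_nat q"] exI [of _ t] exI [of _ z] conjI)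
      (simp_all add: A z)
  then show ?thesis unfolding p by blast
qed

lemma residual_relationI:
  assumes v: "U y v = Some w" and q: "U y q = Some (nat_str s)"
    and i: "i < item (str_nat w) 0" and den: "mden (str_nat w) > 0"
    and z: "codeword (cumulative (str_nat y) (str_nat w) s (index_length t (str_nat q)) i)
      (cumulative (str_nat y) (str_nat w) s (index_length t (str_nat q)) (Suc i))
      (mden (str_nat w)) z"
  shows "\<exists>n. residual_relation n (str_nat (code_pair v y))
    (str_nat (q @ code (nat_str t) @ nat_str z)) (mpoint (str_nat w) i)"
proof -
  obtain n n' where "\<forall>k\<ge>n. A k (str_nat y) (str_nat v) = Suc (str_nat w)"
    "\<forall>k\<ge>n'. A k (str_nat y) (str_nat q) = Suc s"
    using stage_complete [OF v] stage_complete [OF q] by auto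
  then have A: "A (max n n') (str_nat y) (str_nat v) = Suc (str_nat w)"
    "A (max n n') (str_nat y) (str_nat q) = Suc s" by simp_all
  have pair: "item (str_nat (code_pair v y)) 0 = str_nat v"
    "item (str_nat (code_pair v y)) 1 = str_nat y"
    using decode_items(2) [of 0 "[v, y]"] decode_items(2) [of 1 "[v, y]"]
    by (simp_all add: code_pair_def)
  let ?p = "scat (str_nat q) (scat (scode t) z)"
  have p: "str_nat (q @ code (nat_str t) @ nat_str z) = ?p"
    by (simp add: scat_def scode_def)
  have "str_nat q < Suc ?p" "t < Suc ?p" "z < Suc ?p"
    using le_scat le_scode unfolding less_Suc_eq_le by (meson le_trans)+
  then have "residual_relation (max n n') (str_nat (code_pair v y)) ?p (mpoint (str_nat w) i)"
    unfolding residual_relation_def pair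
    by (intro exI [of _ "str_nat q"] exI [of _ t] exI [of _ z] exI [of _ i] conjI)
      (simp_all add: A z i den)
  then show ?thesis unfolding p by blast
qed

text \<open>If \<open>D\<close> were missed, its Shannon--Fano code for the residual weights would be short enough to
  make the deficiency of \<open>D\<close> exceed \<open>k\<close>.\<close>

lemma chosen_hits:
  assumes c: "\<forall>n k p x. residual_relation n (str_nat k) (str_nat p) (str_nat x) \<longrightarrow>
      KP U x k \<le> length p + c"
    and m: "elementary_semimeasure m" "finite D" "1 / 2 ^ s \<le> real_of_rat (\<Sum>x\<in>D. m x)"
    and W: "elementary_probability W"
    and v: "U (code_measure m) v = Some (code_measure W)"
    and q: "U (code_measure m) q = Some (nat_str s)"
    and def: "deficiency U (code_set D) W (code_pair v (code_measure m)) \<le> ereal (real k)"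
    and k: "k \<ge> 1"
  defines "t \<equiv> 4 * (5 + c) * k"
  defines "h \<equiv> index_length t (str_nat q)"
  defines "y \<equiv> str_nat (code_measure m)" and "w \<equiv> str_nat (code_measure W)"
  shows "\<exists>z. slen z = s + h \<and> nat_str (digit (chosen y w s h) (Suc y) z) \<in> D"
proof -
  define a where "a = str_nat (code_set D)"
  have "\<not> missed y (s + h) a (chosen y w s h)"
  proof
    assume missed: "missed y (s + h) a (chosen y w s h)"
    define us where "us = sorted_strs (supp W)"
    have W': "\<And>a. W a \<ge> 0" "finite (supp W)"
      using W by (auto simp: elementary_probability_def)
    note dec = decode_measure [of W, OF W'(1,2), folded w_def us_def]
    \<comment> \<open>The deficiency is infinite outside the support, so its finite bound places the
      code of D in the support of W.\<close>
    have W0: "W (code_set D) \<noteq> 0" using def by (auto simp: deficiency_def)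
    moreover have "set us = supp W" unfolding us_def by (rule set_sorted_strs [OF W'(2)])
    ultimately have "code_set D \<in> set us" by (simp add: supp_def)
    then obtain i where i: "i < length us" "us ! i = code_set D" by (auto simp: in_set_conv_nth)
    have point: "mpoint w i = a" using dec(2) i by (simp add: a_def)
    have "supp m \<noteq> {}"
    proof
      assume "supp m = {}"
      then have "(\<Sum>x\<in>D. m x) = 0" by (intro sum.neutral) (auto simp: supp_def)
      moreover have "0 < real_of_rat (\<Sum>x\<in>D. m x)" by (rule less_le_trans [OF _ m(3)]) simp
      ultimately show False by simp
    qed
    then have "covers y w s (s + h) (2 ^ h) (chosen y w s h)"
      using cover_covers [OF m(1) _ W, of s "s + h"] by (simp add: y_def w_def chosen_def)
    then have total: "cumulative y w s h (item w 0) \<le> mden w"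
      unfolding covers_def cumulative_def .
    define A B where "A = cumulative y w s h i" and "B = cumulative y w s h (Suc i)"
    \<comment> \<open>D is heavy and, by assumption, missed, so its residual weight is its full
      weight under W.\<close>
    have res: "residual y w s (s + h) (chosen y w s h) i = mweight w i"
      using missed heavy_code_set [OF m] by (simp add: residual_def point y_def a_def)
    have BA: "B = A + 2 ^ 2 ^ h * mweight w i"
      unfolding A_def B_def cumulative_Suc res ..
    have weight: "real (mweight w i) = of_rat (W (code_set D)) * real (mden w)"
      using dec(4) [OF i(1)] i(2) by simp
    have Wpos: "real_of_rat (W (code_set D)) > 0" using W0 W'(1) [of "code_set D"] by simp
    then have "real (mweight w i) > 0" using weight dec(3) by simp
    then have "A < B" using BA by simp
    moreover have "B \<le> mden w"
      using total cumulative_mono [of "Suc i" "item w 0" y w s h] i(1) dec(1) by (simp add: B_def)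
    ultimately obtain z where z: "codeword A B (mden w) z" "2 ^ slen z * (B - A) \<le> 4 * mden w"
      using codeword_exists by blast
    have "\<exists>n. residual_relation n (str_nat (code_pair v (code_measure m)))
        (str_nat (q @ code (nat_str t) @ nat_str z)) (mpoint (str_nat (code_measure W)) i)"
      using residual_relationI [OF v q, of i t z] i(1) dec(1,3) z(1)
      by (simp add: w_def y_def A_def B_def h_def)
    then obtain n where "residual_relation n (str_nat (code_pair v (code_measure m)))
        (str_nat (q @ code (nat_str t) @ nat_str z)) (str_nat (code_set D))"
      using point by (auto simp: w_def a_def)
    from c [rule_format, OF this] have KP: "KP U (code_set D) (code_pair v (code_measure m))
        \<le> length q + (2 * slen t + 1) + slen z + c"
      by (simp add: length_code slen_def)
    have "real (2 ^ slen z * (B - A)) \<le> real (4 * mden w)"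
      using z(2) by (simp only: of_nat_le_iff)
    then have "2 ^ slen z * (2 ^ 2 ^ h * real_of_rat (W (code_set D))) * real (mden w) \<le> 4 * real (mden w)"
      by (simp add: BA weight mult_ac)
    then have "2 ^ slen z * (2 ^ 2 ^ h * real_of_rat (W (code_set D))) \<le> 4"
      using dec(3) by (simp only: mult_le_cancel_right_pos of_nat_0_less_iff)
    then have "log 2 (2 ^ slen z * (2 ^ 2 ^ h * real_of_rat (W (code_set D)))) \<le> log 2 (2 ^ 2)"
      using Wpos by (subst log_le_cancel_iff) simp_all
    also have "\<dots> = 2" by (subst log_pow_cancel) simp_all
    finally have "log 2 (2 ^ slen z * (2 ^ 2 ^ h * real_of_rat (W (code_set D)))) \<le> 2" .
    then have "real (slen z) + (2 ^ h + log 2 (real_of_rat (W (code_set D)))) \<le> 2"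
      using Wpos by (simp add: log_mult log_nat_power)
    moreover have "real_of_int \<lfloor>- log 2 (real_of_rat (W (code_set D)))\<rfloor>
        - real (KP U (code_set D) (code_pair v (code_measure m))) \<le> real k"
      using def W0 by (simp add: deficiency_def)
    moreover have "- log 2 (real_of_rat (W (code_set D))) - 1
        < real_of_int \<lfloor>- log 2 (real_of_rat (W (code_set D)))\<rfloor>" by linarith
    moreover have "real (KP U (code_set D) (code_pair v (code_measure m)))
        \<le> real (length q) + (2 * real (slen t) + 1) + real (slen z) + real c"
      using KP by (simp flip: of_nat_le_iff [where 'a = real])
    ultimately have "2 ^ h < real k + real (length q) + 2 * real (slen t) + 4 + real c"
      by linarith
    moreover have "k + length q + 2 * slen t + 4 + c < 2 ^ h"
      using index_length_large [OF k, of t c "length q"]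
      by (simp add: t_def h_def index_length_def slen_def)
    then have "real (k + length q + 2 * slen t + 4 + c) < real (2 ^ h)"
      by (simp only: of_nat_less_iff)
    ultimately show False by simp
  qed
  then obtain z where z: "slen z = s + h" "item_of (digit (chosen y w s h) (Suc y) z) a"
    unfolding missed_def by blast
  with item_of_code_set [OF m(2)] show ?thesis unfolding a_def by blast
qed

text \<open>In the constant, the 2 is one delimiter bit for t and one unit for rounding
  \<open>- log 2 r\<close> up to s. The logarithm is what remains of 3 log t after 3 log k has gone
  into the stochasticity.\<close>

lemma complexity_bound:
  assumes U: "universal_machine U"
    and c1: "\<forall>n y p x. index_relation n (str_nat y) (str_nat p) (str_nat x) \<longrightarrow>
      KP U x y \<le> length p + c1"
    and c2: "\<forall>n y p x. residual_relation n (str_nat y) (str_nat p) (str_nat x) \<longrightarrow>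
      KP U x y \<le> length p + c2"
    and m: "elementary_semimeasure m" "finite D" "(\<Sum>x\<in>D. m x) > 0"
  shows "real (MIN x\<in>D. KP U x (code_measure m))
        \<le> - log 2 (of_rat (\<Sum>x\<in>D. m x))
          + 2 * real (KP U (nat_str (nat \<lceil>- log 2 (of_rat (\<Sum>x\<in>D. m x))\<rceil>)) (code_measure m))
          + stochasticity U (code_set D) (code_measure m)
          + (real c1 + 2 + 3 * log 2 (8 * (5 + real c2)))"
proof -
  define r where "r = real_of_rat (\<Sum>x\<in>D. m x)"
  define s where "s = nat \<lceil>- log 2 r\<rceil>"
  define y where "y = code_measure m"
  have r0: "r > 0" using m(3) by (simp add: r_def)
  have r1: "r \<le> 1"
  proof -
    have m': "\<And>a. m a \<ge> 0" "finite (supp m)" "(\<Sum>a\<in>supp m. m a) \<le> 1"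
      using m(1) by (auto simp: elementary_semimeasure_def)
    have "(\<Sum>x\<in>D. m x) = (\<Sum>x\<in>supp m \<inter> D. m x)"
      using m(2) by (intro sum.mono_neutral_right) (auto simp: supp_def)
    also have "\<dots> \<le> (\<Sum>a\<in>supp m. m a)" using m' by (intro sum_mono2) auto
    finally have "(\<Sum>x\<in>D. m x) \<le> 1" using m'(3) by simp
    then show ?thesis unfolding r_def by (metis of_rat_1 of_rat_less_eq)
  qed
  have "log 2 r \<le> 0" using r0 r1 by simp
  then have s_ge: "- log 2 r \<le> real s" and s_le: "real s \<le> - log 2 r + 1"
    unfolding s_def by linarith+
  have "1 / 2 ^ s \<le> r"
  proof -
    have "2 powr (- real s) \<le> r" using s_ge r0 by (simp add: le_log_iff [symmetric])
    then show ?thesis by (simp add: powr_minus_divide powr_realpow)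
  qed
  then have mass: "1 / 2 ^ s \<le> real_of_rat (\<Sum>x\<in>D. m x)" by (simp add: r_def)
  obtain q where q: "U y q = Some (nat_str s)" "length q = KP U (nat_str s) y"
    using KP_attained [OF U] by blast
  obtain k v W where k: "stochasticity U (code_set D) y = real (length v) + 3 * log 2 (real k)" "k \<ge> 1"
    and W: "elementary_probability W" "U y v = Some (code_measure W)"
      "deficiency U (code_set D) W (code_pair v y) \<le> ereal (real k)"
    using stochasticity_attained(1) [OF U, of "code_set D" y] unfolding stoch_values_def by blast
  define t where "t = 4 * (5 + c2) * k"
  define h where "h = index_length t (str_nat q)"
  define e where "e = chosen (str_nat y) (str_nat (code_measure W)) s h"
  obtain z where z: "slen z = s + h" "nat_str (digit e (Suc (str_nat y)) z) \<in> D"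
    using chosen_hits [OF c2 m(1,2) mass W(1) W(2) [unfolded y_def] q(1) [unfolded y_def]
        W(3) [unfolded y_def] k(2)]
    unfolding e_def h_def t_def y_def by blast
  let ?x = "nat_str (digit e (Suc (str_nat y)) z)"
  obtain n where "index_relation n (str_nat y) (str_nat (v @ q @ code (nat_str t) @ nat_str z)) (str_nat ?x)"
    using index_relationI [OF W(2) q(1), of z t] z(1) by (auto simp: h_def e_def)
  from c1 [rule_format, OF this] have "KP U ?x y \<le> length v + length q + (2 * slen t + 1) + (s + h) + c1"
    using z(1) by (simp add: length_code slen_def)
  moreover have "(MIN x\<in>D. KP U x y) \<le> KP U ?x y"
    using m(2) z(2) by (intro Min_le) auto
  \<comment> \<open>Estimating log |q| by |q| yields the second copy of the complexity of s.\<close>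
  moreover have "h \<le> slen t + length q"
    using slen_le [of "length q"] by (simp add: h_def index_length_def slen_def)
  ultimately have "(MIN x\<in>D. KP U x y) \<le> length v + 2 * length q + 3 * slen t + 1 + s + c1"
    by linarith
  then have "real (MIN x\<in>D. KP U x y)
      \<le> real (length v) + 2 * real (length q) + 3 * real (slen t) + 1 + real s + real c1"
    by (simp flip: of_nat_le_iff [where 'a = real])
  moreover have "real (slen t) \<le> log 2 (8 * (5 + real c2)) + log 2 (real k)"
  proof -
    have "1 \<le> t" using k(2) by (simp add: t_def)
    \<comment> \<open>Twice t bounds \<open>Suc t\<close>, so the logarithm of \<open>Suc t\<close>
      splits into log k and a constant.\<close>
    moreover have "8 * (5 + c2) * k = t + t" by (simp add: t_def algebra_simps)
    ultimately have "Suc t \<le> 8 * (5 + c2) * k" by linarith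
    then have "real (Suc t) \<le> real (8 * (5 + c2) * k)" by (simp only: of_nat_le_iff)
    also have "real (8 * (5 + c2) * k) = 8 * (5 + real c2) * real k" by simp
    finally have "log 2 (Suc t) \<le> log 2 (8 * (5 + real c2) * real k)"
      by (subst log_le_cancel_iff) (use k(2) in \<open>simp_all add: add_pos_nonneg\<close>)
    also have "\<dots> = log 2 (8 * (5 + real c2)) + log 2 (real k)"
      by (rule log_mult_pos) (use k(2) in \<open>simp_all add: add_pos_nonneg\<close>)
    finally show ?thesis using slen_le_log [of t] by linarith
  qed
  ultimately have "real (MIN x\<in>D. KP U x y) \<le> - log 2 r + 2 * real (length q)
      + stochasticity U (code_set D) y + (real c1 + 2 + 3 * log 2 (8 * (5 + real c2)))"
    using k(1) s_le by linarith
  then show ?thesis unfolding q(2) s_def r_def y_def .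
qed

end

theorem theorem1:
  fixes U :: machine
  assumes "universal_machine U" and "left_total_machine U"
  shows "\<exists>c::real. \<forall>(m :: str \<Rightarrow> rat) (D :: str set).
    elementary_semimeasure m \<and> finite D \<and> (\<Sum>x\<in>D. m x) > 0 \<longrightarrow>
      real (MIN x\<in>D. KP U x (code_measure m))
        \<le> - log 2 (of_rat (\<Sum>x\<in>D. m x))
          + 2 * real (KP U (nat_str (nat \<lceil>- log 2 (of_rat (\<Sum>x\<in>D. m x))\<rceil>)) (code_measure m))
          + stochasticity U (code_set D) (code_measure m)
          + c"
proof -
  have pf: "prefix_free_machine U" using assms(1) by (simp add: universal_machine_def)
  then have "computable_machine U" by (simp add: prefix_free_machine_def)
  then obtain A where A: "trec (\<lambda>e. A (e 0) (e 1) (e 2))"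
    "\<And>n y p z. A n y p = Suc z \<Longrightarrow> U (nat_str y) (nat_str p) = Some (nat_str z)"
    "\<And>y p x. U y p = Some x \<Longrightarrow> \<exists>n. \<forall>m\<ge>n. A m (str_nat y) (str_nat p) = Suc (str_nat x)"
    by (rule machine_stages) blast
  interpret staged_machine U A
    using pf A by unfold_locales (auto simp: prefix_free_machine_def)
  have "\<exists>c. \<forall>n y p x. index_relation n (str_nat y) (str_nat p) (str_nat x) \<longrightarrow>
      KP U x y \<le> length p + c"
    using index_relation_det
    by (rule complexity_le_of_relation [of U index_relation, OF assms(1) trec_index_relation])
  then obtain c1 where c1: "\<forall>n y p x. index_relation n (str_nat y) (str_nat p) (str_nat x) \<longrightarrow>
      KP U x y \<le> length p + c1" by blast
  have "\<exists>c. \<forall>n y p x. residual_relation n (str_nat y) (str_nat p) (str_nat x) \<longrightarrow>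
      KP U x y \<le> length p + c"
    using residual_relation_det
    by (rule complexity_le_of_relation [of U residual_relation, OF assms(1) trec_residual_relation])
  then obtain c2 where c2: "\<forall>n y p x. residual_relation n (str_nat y) (str_nat p) (str_nat x) \<longrightarrow>
      KP U x y \<le> length p + c2" by blast
  show ?thesis using complexity_bound [OF assms(1) c1 c2] by blast
qed

end
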